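(* Let $\Psi\colon[0,\infty)\to[0,\infty)$, $\Psi(0)=0$, be a continuous strictly increasing function such that $$\limsup_{r\to0}\frac{\Psi(2r)}{\Psi(r)}<4$$ and $$M(r):=\frac{\Psi(r)}{\psi(r)}\to\infty\quad\text{as } r\to0.$$ Then there exist a compact set $K\subset\mathbb{C}$ with $H^\Psi(K)>0$ and a finite (real, not necessarily positive) Borel measure in $\mathbb{C}$, for which $\log(1+|w|)$ is integrable with respect to its total variation, whose logarithmic potential is not differentiable in the capacity sense at $H^\Psi$ almost all points of $K$ (that is, the set of points of $K$ at which it is differentiable in the capacity sense has zero $H^\Psi$ measure).
   Context: $B(a,r)$ is the disc of center $a$ and radius $r$; $\mathbb{C}$ is identified with $\mathbb{R}^2$. The logarithmic potential of a finite Borel measure $\nu$ in $\mathbb{C}$ is $u(z)=\int_{\mathbb{C}}\log\frac{1}{|z-w|}\,d\nu(w)$. $\psi(t)=t\,\frac{1}{\log^2(1/t)}$ for $0<t\le e^{-1}$ and $\psi(t)=t$ for $t\ge e^{-1}$. $H^\Psi$ is the Hausdorff measure associated with $\Psi$: $H^\Psi(E)=\lim_{\delta\to0}\inf\{\sum_i\Psi(\operatorname{diam}E_i):E\subset\bigcup_iE_i,\ \operatorname{diam}E_i\le\delta\}$ (countable coverings). Wiener capacity: for a compact set $E$ contained in a disc of radius $1/2$, $\operatorname{Cap}(E)=\sup\nu(E)$, the supremum being over all positive finite Borel measures $\nu$ supported on $E$ with $\int\log\frac{1}{|z-w|}\,d\nu(w)\le1$ for all $z\in\mathbb{C}$. For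 a non-compact Borel set contained in a disc of radius $1/2$, $\operatorname{Cap}$ is the supremum of the capacities of its compact subsets. Differentiability in the capacity sense: a real function $u$ is differentiable in the capacity sense at $a\in\mathbb{R}^2$ if there exist real numbers $A_1,A_2$ such that, with $Q(x)=\frac{|u(x)-u(a)-\sum_{i=1}^2A_i(x_i-a_i)|}{|x-a|}$, $$\lim_{r\to0}\frac{\sup_{t>0}t\,\operatorname{Cap}(\{x\in B(a,r):Q(x)>t\})}{\operatorname{Cap}(B(a,r))}=0.$$ In particular the integral defining $u(a)$ is required to converge absolutely. The potential $u$ is defined outside a set of capacity zero; points $x$ where it is not defined play no role in the definition. *)

theory Defs
  imports "HOL-Analysis.Analysis"
begin

subsection \<open>Hausdorff measures\<close>

definition psi :: "real \<Rightarrow> real" where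
  "psi t = (if t \<le> exp (-1) then t * (1 / (ln (1 / t))\<^sup>2) else t)"

text \<open>
  The sets of a covering are required to be bounded because \<^const>\<open>diameter\<close> is a real supremum,
  which carries no information about an unbounded set. Finite coverings are included: they
  can be padded with empty sets, which contribute \<open>\<Psi> 0 = 0\<close>.
\<close>

definition hausdorff_content :: "(real \<Rightarrow> real) \<Rightarrow> real \<Rightarrow> complex set \<Rightarrow> ennreal" where
  "hausdorff_content \<Psi> \<delta> E =
     (INF C \<in> {C :: nat \<Rightarrow> complex set. E \<subseteq> (\<Union>i. C i) \<and> (\<forall>i. bounded (C i) \<and> diameter (C i) \<le> \<delta>)}.
        \<Sum>i. ennreal (\<Psi> (diameter (C i))))"

text \<open>
  The content increases as \<open>\<delta>\<close> decreases to \<open>0\<close>, so its limit is a supremum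
  (see \<open>hausdorff_content_tendsto\<close> below).
\<close>

definition hausdorff_measure :: "(real \<Rightarrow> real) \<Rightarrow> complex set \<Rightarrow> ennreal" where
  "hausdorff_measure \<Psi> E = (SUP \<delta>\<in>{0<..}. hausdorff_content \<Psi> \<delta> E)"

lemma hausdorff_content_antimono:
  assumes "\<delta> \<le> \<delta>'"
  shows "hausdorff_content \<Psi> \<delta>' E \<le> hausdorff_content \<Psi> \<delta> E"
  unfolding hausdorff_content_def
  by (rule INF_superset_mono) (use assms in \<open>auto intro: order_trans[of _ \<delta> \<delta>']\<close>)

lemma hausdorff_content_tendsto:
  "((\<lambda>\<delta>. hausdorff_content \<Psi> \<delta> E) \<longlongrightarrow> hausdorff_measure \<Psi> E) (at_right 0)"
proof (rule order_tendstoI)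
  fix x assume "x < hausdorff_measure \<Psi> E"
  then obtain d where d: "d > 0" "x < hausdorff_content \<Psi> d E"
    unfolding hausdorff_measure_def less_SUP_iff by auto
  have "x < hausdorff_content \<Psi> \<delta> E" if "\<delta> < d" for \<delta>
    using d(2) hausdorff_content_antimono[of \<delta> d] that by (simp add: less_le_trans)
  then show "\<forall>\<^sub>F \<delta> in at_right 0. x < hausdorff_content \<Psi> \<delta> E"
    unfolding eventually_at_right_field using d(1) by blast
next
  fix x assume "hausdorff_measure \<Psi> E < x"
  then have "hausdorff_content \<Psi> \<delta> E < x" if "\<delta> > 0" for \<delta>
    using that unfolding hausdorff_measure_def
    by (meson SUP_upper greaterThan_iff le_less_trans)
  then show "\<forall>\<^sub>F \<delta> in at_right 0. hausdorff_content \<Psi> \<delta> E < x"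
    unfolding eventually_at_right_field by (meson zero_less_one)
qed

subsection \<open>Finite real Borel measures\<close>

text \<open>
  A finite real (signed) measure is a countably additive real-valued set function on the Borel
  sets; its values on other sets are irrelevant.
\<close>

definition signed_borel_measure :: "(complex set \<Rightarrow> real) \<Rightarrow> bool" where
  "signed_borel_measure \<nu> \<longleftrightarrow> \<nu> {} = 0 \<and>
     (\<forall>A :: nat \<Rightarrow> complex set. range A \<subseteq> sets borel \<longrightarrow> disjoint_family A \<longrightarrow>
        (\<lambda>i. \<nu> (A i)) sums \<nu> (\<Union>i. A i))"

text \<open>
  Positive, negative and total variation of \<open>\<nu>\<close>. Negative values are truncated to \<open>0\<close> by
  \<^const>\<open>ennreal\<close>, which does not change the suprema since \<open>B = {}\<close> is allowed.
\<close>

definition pos_variation :: "(complex set \<Rightarrow> real) \<Rightarrow> complex measure" where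
  "pos_variation \<nu> = measure_of UNIV (sets borel)
     (\<lambda>A. SUP B\<in>{B \<in> sets borel. B \<subseteq> A}. ennreal (\<nu> B))"

definition neg_variation :: "(complex set \<Rightarrow> real) \<Rightarrow> complex measure" where
  "neg_variation \<nu> = pos_variation (\<lambda>A. - \<nu> A)"

definition total_variation :: "(complex set \<Rightarrow> real) \<Rightarrow> complex measure" where
  "total_variation \<nu> = measure_of UNIV (sets borel)
     (\<lambda>A. emeasure (pos_variation \<nu>) A + emeasure (neg_variation \<nu>) A)"

lemma signed_borel_measure_uminus:
  "signed_borel_measure \<nu> \<Longrightarrow> signed_borel_measure (\<lambda>A. - \<nu> A)"
  unfolding signed_borel_measure_def by (auto intro: sums_minus)

lemma signed_borel_measure_Un:
  assumes \<nu>: "signed_borel_measure \<nu>" and AB: "A \<in> sets borel" "B \<in> sets borel" "A \<inter> B = {}"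
  shows "\<nu> (A \<union> B) = \<nu> A + \<nu> B"
proof -
  have "range (binaryset A B) \<subseteq> sets borel" "disjoint_family (binaryset A B)"
    using AB by (auto simp: range_binaryset_eq disjoint_family_on_def binaryset_def)
  then have "(\<lambda>i. \<nu> (binaryset A B i)) sums \<nu> (\<Union>i. binaryset A B i)"
    using \<nu> unfolding signed_borel_measure_def by blast
  moreover have "(\<lambda>i. \<nu> (binaryset A B i)) sums (\<nu> A + \<nu> B)"
    using \<nu> unfolding signed_borel_measure_def by (intro binaryset_sums) auto
  ultimately show ?thesis
    by (simp add: UN_binaryset_eq sums_unique2)
qed

text \<open>The set functions above are measures, so \<^const>\<open>measure_of\<close> really yields the variations.\<close>

lemma emeasure_pos_variation:
  assumes \<nu>: "signed_borel_measure \<nu>" and A: "A \<in> sets borel"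
  shows "emeasure (pos_variation \<nu>) A = (SUP B\<in>{B \<in> sets borel. B \<subseteq> A}. ennreal (\<nu> B))"
proof -
  define p where "p A = (SUP B\<in>{B \<in> sets borel. B \<subseteq> A}. ennreal (\<nu> B))" for A
  have upper: "ennreal (\<nu> B) \<le> p A" if "B \<in> sets borel" "B \<subseteq> A" for A B
    using that unfolding p_def by (intro SUP_upper) auto
  have p_empty: "p {} = 0"
  proof -
    have "{B \<in> sets borel. B \<subseteq> ({} :: complex set)} = {{}}" by auto
    then show ?thesis using \<nu> by (simp add: p_def signed_borel_measure_def)
  qed
  have two: "p A + p B \<le> p (A \<union> B)" if "A \<inter> B = {}" for A B
  proof -
    have *: "ennreal (\<nu> S) + ennreal (\<nu> T) \<le> p (A \<union> B)"
      if ST: "S \<in> sets borel" "S \<subseteq> A" "T \<in> sets borel" "T \<subseteq> B" for S T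
    proof (cases "\<nu> S \<ge> 0 \<and> \<nu> T \<ge> 0")
      case True
      have "S \<inter> T = {}" using ST \<open>A \<inter> B = {}\<close> by blast
      then have "\<nu> (S \<union> T) = \<nu> S + \<nu> T"
        using signed_borel_measure_Un[OF \<nu>] ST by blast
      moreover have "ennreal (\<nu> (S \<union> T)) \<le> p (A \<union> B)"
        by (rule upper) (use ST in auto)
      ultimately show ?thesis using True by simp
    next
      case False
      then have "ennreal (\<nu> S) = 0 \<or> ennreal (\<nu> T) = 0"
        by (auto simp: ennreal_neg)
      moreover have "ennreal (\<nu> S) \<le> p (A \<union> B)" "ennreal (\<nu> T) \<le> p (A \<union> B)"
        by (rule upper; use ST in auto)+
      ultimately show ?thesis by auto
    qed
    have "p A + ennreal (\<nu> T) \<le> p (A \<union> B)" if T: "T \<in> sets borel" "T \<subseteq> B" for T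
    proof -
      have "p A + ennreal (\<nu> T) = (SUP S\<in>{S \<in> sets borel. S \<subseteq> A}. ennreal (\<nu> S) + ennreal (\<nu> T))"
        unfolding p_def by (rule ennreal_SUP_add_left[symmetric]) auto
      also have "\<dots> \<le> p (A \<union> B)" by (rule SUP_least) (use * T in auto)
      finally show ?thesis .
    qed
    moreover have "p A + p B = (SUP T\<in>{T \<in> sets borel. T \<subseteq> B}. p A + ennreal (\<nu> T))"
      unfolding p_def[of B] by (rule ennreal_SUP_add_right) auto
    ultimately show ?thesis by (auto intro: SUP_least)
  qed
  have mono: "p A \<le> p B" if "A \<subseteq> B" for A B
    unfolding p_def by (rule SUP_subset_mono) (use that in auto)
  have "countably_additive (sets borel) p"
  proof (rule countably_additiveI)
    fix A :: "nat \<Rightarrow> complex set"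
    assume rA: "range A \<subseteq> sets borel" and dA: "disjoint_family A"
    have fin: "(\<Sum>i<n. p (A i)) \<le> p (\<Union>i<n. A i)" for n
    proof (induction n)
      case 0 then show ?case by simp
    next
      case (Suc n)
      have "A i \<inter> A n = {}" if "i < n" for i
        using dA that by (simp add: disjoint_family_on_def)
      then have dis: "(\<Union>i<n. A i) \<inter> A n = {}" by blast
      have "(\<Sum>i<Suc n. p (A i)) \<le> p (\<Union>i<n. A i) + p (A n)"
        using Suc by (simp add: add_right_mono)
      also have "p (\<Union>i<n. A i) + p (A n) \<le> p ((\<Union>i<n. A i) \<union> A n)" by (rule two) (rule dis)
      also have "(\<Union>i<n. A i) \<union> A n = (\<Union>i<Suc n. A i)" by (auto simp: less_Suc_eq)
      finally show ?case .
    qed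
    show "(\<Sum>i. p (A i)) = p (\<Union>i. A i)"
    proof (rule antisym)
      show "(\<Sum>i. p (A i)) \<le> p (\<Union>i. A i)"
        by (rule suminf_le_const) (auto intro: order_trans[OF fin mono])
    next
      show "p (\<Union>i. A i) \<le> (\<Sum>i. p (A i))"
        unfolding p_def[of "\<Union>i. A i"]
      proof (rule SUP_least)
        fix B assume "B \<in> {B \<in> sets borel. B \<subseteq> (\<Union>i. A i)}"
        then have B: "B \<in> sets borel" "B \<subseteq> (\<Union>i. A i)" by auto
        have "range (\<lambda>i. B \<inter> A i) \<subseteq> sets borel" using rA B by auto
        moreover have "disjoint_family (\<lambda>i. B \<inter> A i)"
          using dA by (auto simp: disjoint_family_on_def)
        moreover have "(\<Union>i. B \<inter> A i) = B" using B by auto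
        ultimately have "(\<lambda>i. \<nu> (B \<inter> A i)) sums \<nu> B"
          using \<nu> unfolding signed_borel_measure_def by metis
        then have lim: "(\<lambda>n. ennreal (\<Sum>i<n. \<nu> (B \<inter> A i))) \<longlonglongrightarrow> ennreal (\<nu> B)"
          unfolding sums_def by (rule tendsto_ennrealI)
        have "ennreal (\<Sum>i<n. \<nu> (B \<inter> A i)) \<le> (\<Sum>i. p (A i))" for n
        proof -
          have "ennreal (\<Sum>i<n. \<nu> (B \<inter> A i)) \<le> (\<Sum>i<n. ennreal (\<nu> (B \<inter> A i)))"
          proof (induction n)
            case (Suc n)
            have sub: "ennreal (x + y) \<le> ennreal x + ennreal y" for x y
              by (cases "x \<ge> 0"; cases "y \<ge> 0") (auto simp: ennreal_neg intro!: ennreal_leI)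
            show ?case
              using order_trans[OF sub add_right_mono[OF Suc]] by simp
          qed simp
          also have "\<dots> \<le> (\<Sum>i<n. p (A i))"
            by (intro sum_mono upper) (use rA B in auto)
          also have "\<dots> \<le> (\<Sum>i. p (A i))"
            by (rule sum_le_suminf) auto
          finally show ?thesis .
        qed
        then show "ennreal (\<nu> B) \<le> (\<Sum>i. p (A i))"
          by (intro LIMSEQ_le_const2[OF lim]) auto
      qed
    qed
  qed
  moreover have "sigma_algebra UNIV (sets (borel :: complex measure))"
    using sets.sigma_algebra_axioms[of "borel :: complex measure"] by simp
  moreover have "positive (sets borel) p"
    using p_empty by (simp add: positive_def)
  ultimately have "emeasure (measure_of UNIV (sets borel) p) A = p A"
    using A by (intro emeasure_measure_of_sigma)
  then show ?thesis unfolding pos_variation_def p_def .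
qed

lemma sets_pos_variation [simp]: "sets (pos_variation \<nu>) = sets borel"
  unfolding pos_variation_def by (simp add: sets.sigma_sets_eq[of "borel :: complex measure", simplified])

lemma sets_neg_variation [simp]: "sets (neg_variation \<nu>) = sets borel"
  unfolding neg_variation_def by simp

lemma emeasure_total_variation:
  assumes "A \<in> sets borel"
  shows "emeasure (total_variation \<nu>) A = emeasure (pos_variation \<nu>) A + emeasure (neg_variation \<nu>) A"
proof -
  have "sigma_algebra UNIV (sets (borel :: complex measure))"
    using sets.sigma_algebra_axioms[of "borel :: complex measure"] by simp
  moreover have "countably_additive (sets borel)
      (\<lambda>A. emeasure (pos_variation \<nu>) A + emeasure (neg_variation \<nu>) A)"
    by (rule countably_additiveI)
       (simp add: suminf_add[symmetric] suminf_emeasure)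
  ultimately show ?thesis
    unfolding total_variation_def using assms
    by (intro emeasure_measure_of_sigma) (auto simp: positive_def)
qed

subsection \<open>Logarithmic potentials\<close>

text \<open>
  On the diagonal the kernel is \<open>+\<infinity>\<close>; as \<open>ln 0 = 0\<close> in the library, a real-valued kernel would
  ignore atoms.
\<close>

definition log_kernel :: "complex \<Rightarrow> complex \<Rightarrow> ereal" where
  "log_kernel z w = (if z = w then \<infinity> else ereal (ln (1 / cmod (z - w))))"

text \<open>
  Potential of a positive measure, as the integral of the positive part of the kernel minus that
  of the negative part (\<^const>\<open>e2ennreal\<close> truncates negative values to \<open>0\<close>).
\<close>

definition pos_log_potential :: "complex measure \<Rightarrow> complex \<Rightarrow> ereal" where
  "pos_log_potential M z =
     enn2ereal (\<integral>\<^sup>+ w. e2ennreal (log_kernel z w) \<partial>M) -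
     enn2ereal (\<integral>\<^sup>+ w. e2ennreal (- log_kernel z w) \<partial>M)"

definition log_potential_domain :: "(complex set \<Rightarrow> real) \<Rightarrow> complex set" where
  "log_potential_domain \<nu> =
     {z. (\<integral>\<^sup>+ w. e2ennreal \<bar>log_kernel z w\<bar> \<partial>total_variation \<nu>) < \<infinity>}"

text \<open>Meaningful on \<^const>\<open>log_potential_domain\<close>, where both terms of the difference are finite.\<close>

definition log_potential :: "(complex set \<Rightarrow> real) \<Rightarrow> complex \<Rightarrow> real" where
  "log_potential \<nu> z =
     real_of_ereal (pos_log_potential (pos_variation \<nu>) z - pos_log_potential (neg_variation \<nu>) z)"

subsection \<open>Wiener capacity\<close>

text \<open>Intended only for subsets of a disc of radius \<open>1 / 2\<close>.\<close>

definition compact_capacity :: "complex set \<Rightarrow> ennreal" where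
  "compact_capacity E =
     (SUP \<nu> \<in> {\<nu> :: complex measure. sets \<nu> = sets borel \<and> finite_measure \<nu> \<and>
                emeasure \<nu> (- E) = 0 \<and> (\<forall>z. pos_log_potential \<nu> z \<le> 1)}.
        emeasure \<nu> E)"

definition capacity :: "complex set \<Rightarrow> ennreal" where
  "capacity E = (if compact E then compact_capacity E
                 else (SUP K \<in> {K. compact K \<and> K \<subseteq> E}. compact_capacity K))"

subsection \<open>Differentiability in the capacity sense\<close>

text \<open>
  The function \<open>u\<close> is only considered on \<open>D\<close>. The point \<open>x = a\<close> is never in the set whose
  capacity is taken, because \<open>0 / 0 = 0\<close> in the library.
\<close>

definition capacity_differentiable ::
    "complex set \<Rightarrow> (complex \<Rightarrow> real) \<Rightarrow> complex \<Rightarrow> bool" where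
  "capacity_differentiable D u a \<longleftrightarrow> a \<in> D \<and>
     (\<exists>A1 A2 :: real.
        let Q = (\<lambda>x. \<bar>u x - u a - (A1 * (Re x - Re a) + A2 * (Im x - Im a))\<bar> / cmod (x - a))
        in ((\<lambda>r. (SUP t\<in>{0<..}. ennreal t * capacity {x \<in> ball a r. x \<in> D \<and> Q x > t})
                  / capacity (ball a r)) \<longlongrightarrow> 0) (at_right 0))"

end

theory Submission
  imports Defs
begin

text \<open>
  Differentiability in the capacity sense at a point \<open>a\<close> fails as soon as the potential has too
  many logarithmic poles near \<open>a\<close>. Suppose that \<open>\<nu>\<close> is positive and has atoms \<open>p\<close> of mass \<open>m\<^sub>p\<close> in
  \<open>B(a, r)\<close>. Near \<open>p\<close> the potential is at least \<open>m\<^sub>p log (1 / |x - p|) - C\<close>, so for large \<open>t\<close> the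
  quotient \<open>Q\<close> exceeds \<open>t\<close> on a disc about \<open>p\<close> of radius \<open>\<rho>\<^sub>p\<close> with \<open>log (1 / \<rho>\<^sub>p)\<close> comparable to
  \<open>t |p - a| / m\<^sub>p\<close>. As \<open>t \<rightarrow> \<infinity>\<close> these discs become so small compared with their mutual distances
  that they hardly interact, and the capacity of their union is comparable to the sum of their
  capacities, that is, to \<open>t\<^sup>-\<^sup>1 \<Sum> m\<^sub>p / |p - a|\<close>. Since \<open>Cap (B(a, r)) \<le> 1 / log (1 / r)\<close>, the potential
  is not differentiable at \<open>a\<close> if
  \<open>log (1 / r) \<Sum>\<^bsub>p \<in> B(a, r) - {a}\<^esub> m\<^sub>p / |p - a|\<close> does not tend to \<open>0\<close>. This is
  \<open>not_capacity_differentiable\<close>; the linear part of \<open>Q\<close> and the value \<open>u(a)\<close> are absorbed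
  because \<open>t\<close> is sent to infinity for each fixed \<open>r\<close>.

  The set \<open>K\<close> is the corner Cantor set whose \<open>4\<^sup>n\<close> squares of generation \<open>n\<close> have side \<open>s\<^sub>n\<close> with
  \<open>\<Psi>(s\<^sub>n) = h 4\<^sup>-\<^sup>n\<close>. The bound on \<open>\<Psi>(2r) / \<Psi>(r)\<close> gives \<open>s\<^sub>n\<^sub>+\<^sub>1 < s\<^sub>n / 2\<close>, so four
  squares of side \<open>s\<^sub>n\<^sub>+\<^sub>1\<close> fit into the corners of a square of side \<open>s\<^sub>n\<close>, and counting squares gives
  \<open>H\<^sup>\<Psi>(K) > 0\<close>. Spread unit mass equally over the lower left corners of generation \<open>2n\<close>. Then
  around any \<open>a \<in> K\<close> generation \<open>j\<close> contributes about \<open>4\<^sup>-\<^sup>j / s\<^sub>j\<close> to the sum above, and if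
  \<open>log (1 / s\<^sub>j)\<close> is of order \<open>j\<close> this is comparable to \<open>M(s\<^sub>j) / j\<^sup>2\<close> (otherwise it is at least \<open>1\<close>).
  The generations \<open>n \<le> j < 2n\<close>, all at distance less than \<open>3 s\<^sub>n\<close> from \<open>a\<close>, together give at
  least about \<open>min n (M / n)\<close>, while \<open>log (1 / s\<^sub>n)\<close> is at least of order \<open>n\<close>; the product is at least of
  order \<open>min n\<^sup>2 M\<close>. Because \<open>M \<rightarrow> \<infinity>\<close>, masses \<open>2\<^sup>-\<^sup>k\<close> can be placed at generations \<open>2 n\<^sub>k\<close> with \<open>n\<^sub>k \<ge> 2\<^sup>k\<close> and \<open>M \<ge> 2\<^sup>k\<close> from
  generation \<open>n\<^sub>k\<close> on: the total mass is finite, and every point of \<open>K\<close> is bad at all the scales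
  \<open>3 s\<^bsub>n\<^sub>k\<^esub>\<close>.
\<close>

section \<open>The logarithmic kernel and area\<close>

lemma measurable_log_kernel [measurable]:
  "(\<lambda>x. log_kernel (fst x) (snd x)) \<in> borel_measurable (borel \<Otimes>\<^sub>M borel)"
  unfolding log_kernel_def by measurable

lemma log_kernel_sym: "log_kernel z w = log_kernel w z"
  by (simp add: log_kernel_def norm_minus_commute)

lemma measurable_log_kernel1 [measurable]:
  "log_kernel z \<in> borel_measurable borel"
  unfolding log_kernel_def by measurable

text \<open>
  The logarithm is replaced by a count of dyadic scales, so that integrals of the kernel become
  geometric series of areas of discs.
\<close>

lemma ln_le_card_powers_of_2:
  assumes "x \<ge> 1"
  obtains m where "ln x \<le> real m" "\<And>n. n < m \<Longrightarrow> 2 ^ n \<le> (x::real)"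
proof -
  obtain k where k: "x < 2 ^ k" using real_arch_pow[of 2 x] by auto
  define m where "m = (LEAST k. x < 2 ^ k)"
  have m: "x < 2 ^ m" unfolding m_def using k by (rule LeastI)
  have "2 ^ n \<le> x" if "n < m" for n
    using not_less_Least[of n "\<lambda>k. x < 2 ^ k"] that by (auto simp: m_def not_less)
  moreover have "ln x \<le> real m"
  proof -
    have "ln x \<le> ln (2 ^ m)" using m assms by (subst ln_le_cancel_iff) auto
    also have "\<dots> = m * ln 2" by (simp add: ln_realpow)
    also have "\<dots> \<le> real m * 1" using ln_2_less_1 by (intro mult_left_mono) auto
    finally show ?thesis by simp
  qed
  ultimately show ?thesis using that by blast
qed

lemma log_kernel_le_dyadic:
  assumes "0 < \<rho>" "\<rho> \<le> 1"
  shows "e2ennreal (log_kernel z w) \<le>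
    ennreal (ln (1 / \<rho>)) + (\<Sum>n. indicator (cball z (\<rho> * (1/2) ^ n)) w)"
proof -
  define f where "f n = (indicator (cball z (\<rho> * (1/2) ^ n)) w :: ennreal)" for n
  have f_ge: "of_nat m \<le> (\<Sum>n. f n)" if "\<And>n. n < m \<Longrightarrow> w \<in> cball z (\<rho> * (1/2) ^ n)" for m
  proof -
    have "of_nat m = (\<Sum>n<m. f n)" using that by (simp add: f_def)
    also have "\<dots> \<le> (\<Sum>n. f n)" by (rule sum_le_suminf) auto
    finally show ?thesis .
  qed
  consider "z = w" | "z \<noteq> w" "cmod (z - w) \<ge> \<rho>" | "z \<noteq> w" "cmod (z - w) < \<rho>" by linarith
  then have "e2ennreal (log_kernel z w) \<le> ennreal (ln (1 / \<rho>)) + (\<Sum>n. f n)"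
  proof cases
    case 1
    then have "of_nat m \<le> (\<Sum>n. f n)" for m by (intro f_ge) (use assms in auto)
    then have "(\<Sum>n. f n) = top"
      by (metis ennreal_Ex_less_of_nat less_top not_less)
    then show ?thesis by simp
  next
    case 2
    have "ln (1 / cmod (z - w)) \<le> ln (1 / \<rho>)"
      using 2 assms by (subst ln_le_cancel_iff) (auto simp: frac_le)
    then have "e2ennreal (log_kernel z w) \<le> ennreal (ln (1 / \<rho>))"
      using 2 by (simp add: log_kernel_def ennreal_leI)
    then show ?thesis by (simp add: add_increasing2)
  next
    case 3
    define d where "d = cmod (z - w)"
    have d: "d > 0" "d < \<rho>" using 3 by (auto simp: d_def)
    obtain m where m: "ln (\<rho> / d) \<le> real m" "\<And>n. n < m \<Longrightarrow> 2 ^ n \<le> \<rho> / d"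
      using ln_le_card_powers_of_2[of "\<rho> / d"] d by (auto simp: field_simps)
    have "ln (1 / d) = ln (1 / \<rho>) + ln (\<rho> / d)" using d assms by (simp add: ln_div)
    also have "\<dots> \<le> ln (1 / \<rho>) + real m" using m by simp
    finally have "ennreal (ln (1 / d)) \<le> ennreal (ln (1 / \<rho>) + real m)" by (rule ennreal_leI)
    also have "\<dots> = ennreal (ln (1 / \<rho>)) + of_nat m"
      using assms by (subst ennreal_plus) (auto simp: ennreal_of_nat_eq_real_of_nat)
    also have "of_nat m \<le> (\<Sum>n. f n)"
    proof (rule f_ge)
      fix n assume "n < m"
      then have "d \<le> \<rho> * (1/2) ^ n" using m(2)[of n] d by (simp add: field_simps)
      then show "w \<in> cball z (\<rho> * (1/2) ^ n)" by (simp add: d_def dist_norm)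
    qed
    finally show ?thesis using 3 by (simp add: log_kernel_def d_def add_left_mono)
  qed
  then show ?thesis by (simp add: f_def)
qed

lemma emeasure_lborel_cball_complex:
  "r \<ge> 0 \<Longrightarrow> emeasure lborel (cball (z::complex) r) = ennreal (pi * r\<^sup>2)"
  using emeasure_cball[of r z] by (simp add: unit_ball_vol_2)

text \<open>
  For a disc \<open>A\<close> of radius \<open>\<rho>\<close> this says that normalised area has a potential of at most
  \<open>log (1 / \<rho>) + 2\<close> everywhere. The equilibrium potential is \<open>log (1 / \<rho>)\<close>, so area, which does not see
  null sets, can stand in for the equilibrium measure.
\<close>

lemma area_log_kernel_le:
  assumes "0 < \<rho>" "\<rho> \<le> 1" "A \<in> sets borel"
  shows "(\<integral>\<^sup>+w\<in>A. e2ennreal (log_kernel z w) \<partial>lborel)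
     \<le> ennreal (ln (1 / \<rho>)) * emeasure lborel A + ennreal (2 * pi * \<rho>\<^sup>2)"
proof -
  have pow: "(2 ^ n)\<^sup>2 = (4 ^ n :: real)" for n :: nat
    using power_mult_distrib[of "2::real" 2 n] by (simp add: power2_eq_square)
  have discs: "(\<integral>\<^sup>+w. (\<Sum>n. indicator (cball z (\<rho> * (1/2) ^ n)) w) \<partial>lborel)
      = (\<Sum>n. emeasure lborel (cball z (\<rho> * (1/2) ^ n)))"
    by (subst nn_integral_suminf) (auto intro!: borel_measurable_indicator)
  have "(\<integral>\<^sup>+w\<in>A. e2ennreal (log_kernel z w) \<partial>lborel) \<le>
     (\<integral>\<^sup>+w. ennreal (ln (1 / \<rho>)) * indicator A w
        + (\<Sum>n. indicator (cball z (\<rho> * (1/2) ^ n)) w) \<partial>lborel)"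
    using log_kernel_le_dyadic[OF assms(1,2), of z]
    by (intro nn_integral_mono) (auto simp: indicator_def)
  also have "\<dots> = ennreal (ln (1 / \<rho>)) * emeasure lborel A
      + (\<Sum>n. emeasure lborel (cball z (\<rho> * (1/2) ^ n)))"
  proof (subst nn_integral_add)
    show "(\<lambda>w. \<Sum>n. indicator (cball z (\<rho> * (1/2) ^ n)) w :: ennreal) \<in> borel_measurable lborel"
      by (intro borel_measurable_suminf_order borel_measurable_indicator) auto
  qed (use assms in \<open>auto simp: nn_integral_cmult_indicator discs\<close>)
  also have "(\<Sum>n. emeasure lborel (cball z (\<rho> * (1/2) ^ n))) = (\<Sum>n. ennreal (pi * \<rho>\<^sup>2 * (1/4) ^ n))"
    using assms pow by (simp add: emeasure_lborel_cball_complex power_mult_distrib power_divide)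
  also have "\<dots> = ennreal (\<Sum>n. pi * \<rho>\<^sup>2 * (1/4) ^ n)"
    by (intro suminf_ennreal2) (auto intro!: summable_mult summable_geometric)
  also have "(\<Sum>n. pi * \<rho>\<^sup>2 * (1/4) ^ n) = pi * \<rho>\<^sup>2 * (4/3)"
    by (subst suminf_mult) (auto simp: suminf_geometric intro!: summable_geometric)
  also have "ennreal (pi * \<rho>\<^sup>2 * (4/3)) \<le> ennreal (2 * pi * \<rho>\<^sup>2)"
    by (intro ennreal_leI) auto
  finally show ?thesis by (simp add: add_left_mono)
qed

section \<open>Capacity\<close>

lemma compact_capacity_mono:
  assumes "K \<subseteq> E" "K \<in> sets borel" "E \<in> sets borel"
  shows "compact_capacity K \<le> compact_capacity E"
  unfolding compact_capacity_def
proof (rule SUP_least)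
  fix \<sigma> :: "complex measure"
  assume "\<sigma> \<in> {\<nu>. sets \<nu> = sets borel \<and> finite_measure \<nu> \<and>
                emeasure \<nu> (- K) = 0 \<and> (\<forall>z. pos_log_potential \<nu> z \<le> 1)}"
  then have \<sigma>: "sets \<sigma> = sets borel" "finite_measure \<sigma>" "emeasure \<sigma> (- K) = 0"
      "\<forall>z. pos_log_potential \<sigma> z \<le> 1" by auto
  have "emeasure \<sigma> (- E) \<le> emeasure \<sigma> (- K)"
    by (rule emeasure_mono) (use assms \<sigma> in auto)
  then have "\<sigma> \<in> {\<nu>. sets \<nu> = sets borel \<and> finite_measure \<nu> \<and>
                emeasure \<nu> (- E) = 0 \<and> (\<forall>z. pos_log_potential \<nu> z \<le> 1)}" using \<sigma> by auto
  moreover have "emeasure \<sigma> K \<le> emeasure \<sigma> E"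
    by (rule emeasure_mono) (use assms \<sigma> in auto)
  ultimately show "emeasure \<sigma> K \<le> (SUP \<nu>\<in>{\<nu>. sets \<nu> = sets borel \<and> finite_measure \<nu> \<and>
                emeasure \<nu> (- E) = 0 \<and> (\<forall>z. pos_log_potential \<nu> z \<le> 1)}. emeasure \<nu> E)"
    by (rule SUP_upper2)
qed

lemma compact_capacity_le_capacity:
  assumes "K \<subseteq> E" "compact K"
  shows "compact_capacity K \<le> capacity E"
proof (cases "compact E")
  case True
  then show ?thesis using assms
    by (auto simp: capacity_def intro!: compact_capacity_mono borel_compact)
next
  case False
  then show ?thesis using assms by (auto simp: capacity_def intro!: SUP_upper)
qed

text \<open>
  The negative part of the kernel only lowers the potential, so it may be dropped when an upper
  bound is wanted.
\<close>

lemma pos_log_potential_le: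
  assumes "(\<integral>\<^sup>+ w. e2ennreal (log_kernel z w) \<partial>M) \<le> 1"
  shows "pos_log_potential M z \<le> 1"
proof -
  have "enn2ereal (\<integral>\<^sup>+ w. e2ennreal (log_kernel z w) \<partial>M) \<le> 1"
    using assms by (simp add: less_eq_ennreal.rep_eq one_ennreal.rep_eq)
  moreover have "0 \<le> enn2ereal (\<integral>\<^sup>+ w. e2ennreal (- log_kernel z w) \<partial>M)" by simp
  ultimately show ?thesis unfolding pos_log_potential_def
    by (metis add_decreasing2 ereal_minus(7) ereal_uminus_le_0_iff minus_ereal_def ereal_0_le_uminus_iff)
qed

text \<open>
  Evaluate the potential at the centre, where the kernel is at least \<open>log (1 / r)\<close> on the whole
  support.
\<close>

lemma compact_capacity_ball_le:
  assumes "0 < r" "r < 1" "K \<subseteq> ball a r" "compact K"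
  shows "compact_capacity K \<le> ennreal (1 / ln (1 / r))"
  unfolding compact_capacity_def
proof (rule SUP_least)
  fix \<sigma> :: "complex measure"
  assume "\<sigma> \<in> {\<nu>. sets \<nu> = sets borel \<and> finite_measure \<nu> \<and>
                emeasure \<nu> (- K) = 0 \<and> (\<forall>z. pos_log_potential \<nu> z \<le> 1)}"
  then have \<sigma>: "sets \<sigma> = sets borel" "finite_measure \<sigma>" "emeasure \<sigma> (- K) = 0"
      "pos_log_potential \<sigma> a \<le> 1" by auto
  have [measurable_cong]: "sets \<sigma> = sets borel" by fact
  have Kb: "K \<in> sets borel" using assms by (auto intro: borel_compact)
  have sp: "space \<sigma> = UNIV" using sets_eq_imp_space_eq[OF \<sigma>(1)] by simp
  have AE: "AE w in \<sigma>. w \<in> K"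
    by (rule AE_I[of _ _ "-K"]) (use \<sigma> Kb sp in auto)
  have ker: "ereal (ln (1 / r)) \<le> log_kernel a w" if "w \<in> K" for w
  proof (cases "a = w")
    case False
    have "cmod (a - w) < r" using that assms by (auto simp: dist_norm)
    then have "ln (1 / r) \<le> ln (1 / cmod (a - w))"
      using False assms by (subst ln_le_cancel_iff) (auto simp: frac_le)
    then show ?thesis using False by (simp add: log_kernel_def)
  qed (simp add: log_kernel_def)
  have L: "ln (1 / r) > 0" using assms by simp
  have "(\<integral>\<^sup>+ w. e2ennreal (- log_kernel a w) \<partial>\<sigma>) = (\<integral>\<^sup>+ w. 0 \<partial>\<sigma>)"
  proof (rule nn_integral_cong_AE, use AE in eventually_elim)
    fix w assume "w \<in> K"
    then have "0 \<le> log_kernel a w" using ker[of w] L by (meson ereal_less_eq(5) less_imp_le order_trans)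
    then show "e2ennreal (- log_kernel a w) = 0" by (intro e2ennreal_neg) simp
  qed
  then have pot: "enn2ereal (\<integral>\<^sup>+ w. e2ennreal (log_kernel a w) \<partial>\<sigma>) \<le> 1"
    using \<sigma>(4) by (simp add: pos_log_potential_def zero_ennreal.rep_eq)
  have "ennreal (ln (1 / r)) * emeasure \<sigma> K = (\<integral>\<^sup>+ w\<in>K. ennreal (ln (1 / r)) \<partial>\<sigma>)"
    using Kb \<sigma> by (simp add: nn_integral_cmult_indicator)
  also have "\<dots> \<le> (\<integral>\<^sup>+ w. e2ennreal (log_kernel a w) \<partial>\<sigma>)"
  proof (rule nn_integral_mono)
    fix w show "ennreal (ln (1 / r)) * indicator K w \<le> e2ennreal (log_kernel a w)"
      using e2ennreal_mono[OF ker, of w] by (auto simp: indicator_def)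
  qed
  also have "\<dots> \<le> 1" using pot by (simp add: less_eq_ennreal.rep_eq one_ennreal.rep_eq)
  finally have le: "ennreal (ln (1 / r)) * emeasure \<sigma> K \<le> 1" .
  obtain x where x: "emeasure \<sigma> K = ennreal x" "x \<ge> 0"
    using finite_measure.emeasure_finite[OF \<sigma>(2)] by (metis ennreal_cases infinity_ennreal_def)
  have "ln (1 / r) * x \<le> 1" using le x L by (simp flip: ennreal_mult)
  then have "x \<le> 1 / ln (1 / r)" using L by (simp add: field_simps)
  then show "emeasure \<sigma> K \<le> ennreal (1 / ln (1 / r))" using x by (simp add: ennreal_leI)
qed

lemma capacity_ball_le:
  assumes "0 < r" "r < 1"
  shows "capacity (ball a r) \<le> ennreal (1 / ln (1 / r))"
  using compact_capacity_ball_le[OF assms] unfolding capacity_def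
  by (auto intro!: SUP_least)

text \<open>
  Capacity is nearly additive on small, well separated discs. The test measure is area on the sets
  \<open>E p\<close>, normalised so that the disc about \<open>p\<close> would carry mass \<open>\<alpha> p\<close>. A point \<open>z\<close> is close to at
  most one disc, whose potential at \<open>z\<close> is at most \<open>1 / 2\<close>; all the others are at distance at least
  \<open>\<delta>\<close> and contribute at most \<open>ln (1 / \<delta>) * \<Sum>\<alpha> \<le> 1 / 2\<close>. Subsets \<open>E p\<close> of half the area are allowed in
  order to avoid the points where a given potential is undefined.
\<close>

lemma compact_capacity_discs_ge:
  fixes F :: "complex set" and E :: "complex \<Rightarrow> complex set" and \<rho> \<alpha> :: "complex \<Rightarrow> real"
  assumes F: "finite F" and \<delta>: "0 < \<delta>" "\<delta> \<le> 1"
    and sep: "\<And>p q. p \<in> F \<Longrightarrow> q \<in> F \<Longrightarrow> p \<noteq> q \<Longrightarrow> 4 * \<delta> \<le> dist p q"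
    and \<rho>: "\<And>p. p \<in> F \<Longrightarrow> 0 < \<rho> p \<and> \<rho> p \<le> \<delta>"
    and E: "\<And>p. p \<in> F \<Longrightarrow> compact (E p) \<and> E p \<subseteq> cball p (\<rho> p)"
    and area: "\<And>p. p \<in> F \<Longrightarrow> ennreal (pi * (\<rho> p)\<^sup>2 / 2) \<le> emeasure lborel (E p)"
    and \<alpha>: "\<And>p. p \<in> F \<Longrightarrow> 0 \<le> \<alpha> p" "\<And>p. p \<in> F \<Longrightarrow> \<alpha> p * (ln (1 / \<rho> p) + 2) \<le> 1 / 2"
    and small: "ln (1 / \<delta>) * (\<Sum>p\<in>F. \<alpha> p) \<le> 1 / 2"
  shows "ennreal ((\<Sum>p\<in>F. \<alpha> p) / 2) \<le> compact_capacity (\<Union>p\<in>F. E p)"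
proof -
  define \<beta> where "\<beta> p = \<alpha> p / (pi * (\<rho> p)\<^sup>2)" for p
  define g :: "complex \<Rightarrow> ennreal" where "g w = (\<Sum>p\<in>F. ennreal (\<beta> p) * indicator (E p) w)" for w
  define \<sigma> where "\<sigma> = density lborel g"
  have Eb [measurable]: "E p \<in> sets borel" if "p \<in> F" for p
    using E[OF that] by (auto intro: borel_compact)
  have \<beta>0: "0 \<le> \<beta> p" if "p \<in> F" for p using \<alpha>(1)[OF that] by (simp add: \<beta>_def)
  have \<beta>\<alpha>: "\<beta> p * (pi * (\<rho> p)\<^sup>2) = \<alpha> p" if "p \<in> F" for p
    using \<rho>[OF that] by (simp add: \<beta>_def)
  have g [measurable]: "g \<in> borel_measurable borel"
    unfolding g_def by (intro borel_measurable_sum borel_measurable_times borel_measurable_indicator) (auto simp: Eb)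
  have int\<sigma>: "(\<integral>\<^sup>+w. h w \<partial>\<sigma>) = (\<Sum>p\<in>F. ennreal (\<beta> p) * (\<integral>\<^sup>+w\<in>E p. h w \<partial>lborel))"
    if h [measurable]: "h \<in> borel_measurable borel" for h :: "complex \<Rightarrow> ennreal"
  proof -
    have "(\<integral>\<^sup>+w. h w \<partial>\<sigma>) = (\<integral>\<^sup>+w. g w * h w \<partial>lborel)"
      unfolding \<sigma>_def by (rule nn_integral_density) auto
    also have "\<dots> = (\<integral>\<^sup>+w. (\<Sum>p\<in>F. ennreal (\<beta> p) * (h w * indicator (E p) w)) \<partial>lborel)"
      by (simp add: g_def sum_distrib_right sum_distrib_left mult.assoc mult.commute mult.left_commute)
    also have "\<dots> = (\<Sum>p\<in>F. (\<integral>\<^sup>+w. ennreal (\<beta> p) * (h w * indicator (E p) w) \<partial>lborel))"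
      by (rule nn_integral_sum) (auto intro!: borel_measurable_times borel_measurable_indicator Eb)
    also have "\<dots> = (\<Sum>p\<in>F. ennreal (\<beta> p) * (\<integral>\<^sup>+w\<in>E p. h w \<partial>lborel))"
      by (intro sum.cong refl nn_integral_cmult)
        (auto intro!: borel_measurable_times borel_measurable_indicator Eb)
    finally show ?thesis .
  qed
  have areaE: "emeasure lborel (E p) \<le> ennreal (pi * (\<rho> p)\<^sup>2)" if "p \<in> F" for p
    using emeasure_mono[of "E p" "cball p (\<rho> p)" lborel] E[OF that] \<rho>[OF that]
    by (simp add: emeasure_lborel_cball_complex)
  have em: "emeasure \<sigma> A = (\<Sum>p\<in>F. ennreal (\<beta> p) * emeasure lborel (A \<inter> E p))"
    if "A \<in> sets borel" for A
  proof -
    have "emeasure \<sigma> A = (\<integral>\<^sup>+w. indicator A w \<partial>\<sigma>)" using that by (simp add: \<sigma>_def)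
    also have "\<dots> = (\<Sum>p\<in>F. ennreal (\<beta> p) * (\<integral>\<^sup>+w\<in>E p. indicator A w \<partial>lborel))"
      using that by (intro int\<sigma>) simp
    also have "\<dots> = (\<Sum>p\<in>F. ennreal (\<beta> p) * emeasure lborel (A \<inter> E p))"
      using that by (intro sum.cong refl) (simp add: Eb flip: indicator_inter_arith)
    finally show ?thesis .
  qed
  have Ub: "(\<Union>p\<in>F. E p) \<in> sets borel" using F by (intro sets.finite_UN) (auto intro: Eb)
  have fin: "emeasure \<sigma> UNIV \<noteq> \<infinity>"
  proof -
    have "emeasure \<sigma> UNIV \<le> (\<Sum>p\<in>F. ennreal (\<alpha> p))"
    proof (subst em)
      show "(\<Sum>p\<in>F. ennreal (\<beta> p) * emeasure lborel (UNIV \<inter> E p)) \<le> (\<Sum>p\<in>F. ennreal (\<alpha> p))"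
      proof (rule sum_mono)
        fix p assume p: "p \<in> F"
        have "ennreal (\<beta> p) * emeasure lborel (E p) \<le> ennreal (\<beta> p) * ennreal (pi * (\<rho> p)\<^sup>2)"
          by (intro mult_left_mono areaE p) simp
        also have "\<dots> = ennreal (\<alpha> p)" using \<beta>\<alpha>[OF p] \<beta>0[OF p] by (simp flip: ennreal_mult'')
        finally show "ennreal (\<beta> p) * emeasure lborel (UNIV \<inter> E p) \<le> ennreal (\<alpha> p)" by simp
      qed
    qed simp
    also have "\<dots> = ennreal (\<Sum>p\<in>F. \<alpha> p)" using \<alpha>(1) by (rule sum_ennreal)
    finally show ?thesis by (auto simp: top_unique)
  qed
  have zero: "emeasure \<sigma> (- (\<Union>p\<in>F. E p)) = 0"
  proof -
    have "- (\<Union>p\<in>F. E p) \<inter> E p = {}" if "p \<in> F" for p using that by auto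
    then have "(\<Sum>p\<in>F. ennreal (\<beta> p) * emeasure lborel (- (\<Union>p\<in>F. E p) \<inter> E p)) = 0"
      by (intro sum.neutral) simp
    then show ?thesis using em[OF borel_comp[OF Ub]] by simp
  qed
  have mass: "ennreal ((\<Sum>p\<in>F. \<alpha> p) / 2) \<le> emeasure \<sigma> (\<Union>p\<in>F. E p)"
  proof -
    have "ennreal ((\<Sum>p\<in>F. \<alpha> p) / 2) = (\<Sum>p\<in>F. ennreal (\<alpha> p / 2))"
      using \<alpha>(1) by (simp add: sum_divide_distrib)
    also have "\<dots> \<le> (\<Sum>p\<in>F. ennreal (\<beta> p) * emeasure lborel ((\<Union>p\<in>F. E p) \<inter> E p))"
    proof (rule sum_mono)
      fix p assume p: "p \<in> F"
      have "ennreal (\<alpha> p / 2) = ennreal (\<beta> p) * ennreal (pi * (\<rho> p)\<^sup>2 / 2)"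
        using \<beta>\<alpha>[OF p] \<beta>0[OF p] by (simp flip: ennreal_mult'')
      also have "\<dots> \<le> ennreal (\<beta> p) * emeasure lborel (E p)"
        using area[OF p] by (rule mult_left_mono) simp
      also have "E p = (\<Union>p\<in>F. E p) \<inter> E p" using p by auto
      finally show "ennreal (\<alpha> p / 2) \<le> ennreal (\<beta> p) * emeasure lborel ((\<Union>p\<in>F. E p) \<inter> E p)" .
    qed
    finally show ?thesis using Ub by (simp add: em)
  qed
  have pot: "pos_log_potential \<sigma> z \<le> 1" for z
  proof (rule pos_log_potential_le)
    define c where "c p = (if dist z p < 2 * \<delta> then 1 / 2 else (0::real))" for p
    have L0: "ln (1 / \<delta>) \<ge> 0" using \<delta> by simp
    have contrib: "ennreal (\<beta> p) * (\<integral>\<^sup>+w\<in>E p. e2ennreal (log_kernel z w) \<partial>lborel)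
        \<le> ennreal (c p + \<alpha> p * ln (1 / \<delta>))" if p: "p \<in> F" for p
    proof (cases "dist z p < 2 * \<delta>")
      case True
      have L: "ln (1 / \<rho> p) \<ge> 0" using \<rho>[OF p] \<delta> by simp
      have "(\<integral>\<^sup>+w\<in>E p. e2ennreal (log_kernel z w) \<partial>lborel)
          \<le> ennreal (ln (1 / \<rho> p)) * emeasure lborel (E p) + ennreal (2 * pi * (\<rho> p)\<^sup>2)"
        using \<rho>[OF p] \<delta> by (intro area_log_kernel_le Eb p) auto
      also have "\<dots> \<le> ennreal (ln (1 / \<rho> p)) * ennreal (pi * (\<rho> p)\<^sup>2) + ennreal (2 * pi * (\<rho> p)\<^sup>2)"
        by (intro add_right_mono mult_left_mono areaE p) auto
      also have "\<dots> = ennreal (pi * (\<rho> p)\<^sup>2 * (ln (1 / \<rho> p) + 2))"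
        using L by (simp add: algebra_simps flip: ennreal_mult'' ennreal_plus)
      finally have "ennreal (\<beta> p) * (\<integral>\<^sup>+w\<in>E p. e2ennreal (log_kernel z w) \<partial>lborel)
          \<le> ennreal (\<beta> p) * ennreal (pi * (\<rho> p)\<^sup>2 * (ln (1 / \<rho> p) + 2))"
        by (rule mult_left_mono) simp
      also have "\<dots> = ennreal (\<beta> p * (pi * (\<rho> p)\<^sup>2) * (ln (1 / \<rho> p) + 2))"
        using \<beta>0[OF p] L by (simp add: mult.assoc flip: ennreal_mult)
      also have "\<dots> \<le> ennreal (c p + \<alpha> p * ln (1 / \<delta>))"
        unfolding \<beta>\<alpha>[OF p] using True \<alpha>(2)[OF p] \<alpha>(1)[OF p] L0
        by (intro ennreal_leI) (auto simp: c_def intro: add_increasing2)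
      finally show ?thesis .
    next
      case False
      have "(\<integral>\<^sup>+w\<in>E p. e2ennreal (log_kernel z w) \<partial>lborel) \<le> (\<integral>\<^sup>+w\<in>E p. ennreal (ln (1 / \<delta>)) \<partial>lborel)"
      proof (rule nn_integral_mono)
        fix w
        have "e2ennreal (log_kernel z w) \<le> ennreal (ln (1 / \<delta>))" if "w \<in> E p"
        proof -
          have "dist p w \<le> \<delta>" using that E[OF p] \<rho>[OF p] by force
          then have d: "\<delta> \<le> cmod (z - w)"
            using False dist_triangle[of z p w] by (simp add: dist_commute flip: dist_norm)
          then have "z \<noteq> w" using \<delta> by auto
          moreover have "ln (1 / cmod (z - w)) \<le> ln (1 / \<delta>)"
            using d \<delta> by (subst ln_le_cancel_iff) (auto simp: frac_le)
          ultimately show ?thesis by (simp add: log_kernel_def ennreal_leI)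
        qed
        then show "e2ennreal (log_kernel z w) * indicator (E p) w \<le> ennreal (ln (1 / \<delta>)) * indicator (E p) w"
          by (auto simp: indicator_def)
      qed
      also have "\<dots> \<le> ennreal (ln (1 / \<delta>)) * ennreal (pi * (\<rho> p)\<^sup>2)"
        using areaE[OF p] by (simp add: nn_integral_cmult_indicator Eb p mult_left_mono)
      finally have "ennreal (\<beta> p) * (\<integral>\<^sup>+w\<in>E p. e2ennreal (log_kernel z w) \<partial>lborel)
          \<le> ennreal (\<beta> p) * (ennreal (ln (1 / \<delta>)) * ennreal (pi * (\<rho> p)\<^sup>2))"
        by (rule mult_left_mono) simp
      also have "\<dots> = ennreal (\<beta> p * (pi * (\<rho> p)\<^sup>2) * ln (1 / \<delta>))"
        using \<beta>0[OF p] L0 by (simp add: algebra_simps flip: ennreal_mult)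
      also have "\<dots> = ennreal (c p + \<alpha> p * ln (1 / \<delta>))"
        unfolding \<beta>\<alpha>[OF p] using False by (simp add: c_def)
      finally show ?thesis .
    qed
    have "(\<Sum>p\<in>F. c p) \<le> 1 / 2"
    proof (cases "\<exists>q\<in>F. dist z q < 2 * \<delta>")
      case True
      then obtain q where q: "q \<in> F" "dist z q < 2 * \<delta>" by blast
      have "c p = 0" if "p \<in> F - {q}" for p
        using sep[of p q] that q dist_triangle[of p q z] by (auto simp: c_def dist_commute)
      then have "(\<Sum>p\<in>F - {q}. c p) = 0" by simp
      then show ?thesis using q F by (simp add: sum.remove[of F q] c_def)
    qed (simp add: c_def)
    then have le1: "(\<Sum>p\<in>F. c p + \<alpha> p * ln (1 / \<delta>)) \<le> 1"
      using small by (simp add: sum.distrib mult.commute flip: sum_distrib_right)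
    have "(\<integral>\<^sup>+w. e2ennreal (log_kernel z w) \<partial>\<sigma>)
       = (\<Sum>p\<in>F. ennreal (\<beta> p) * (\<integral>\<^sup>+w\<in>E p. e2ennreal (log_kernel z w) \<partial>lborel))"
      by (intro int\<sigma>) measurable
    also have "\<dots> \<le> (\<Sum>p\<in>F. ennreal (c p + \<alpha> p * ln (1 / \<delta>)))"
      by (intro sum_mono contrib)
    also have "\<dots> = ennreal (\<Sum>p\<in>F. c p + \<alpha> p * ln (1 / \<delta>))"
      using \<alpha>(1) L0 by (intro sum_ennreal) (auto simp: c_def)
    also have "\<dots> \<le> 1" using le1 by simp
    finally show "(\<integral>\<^sup>+w. e2ennreal (log_kernel z w) \<partial>\<sigma>) \<le> 1" .
  qed
  have "emeasure \<sigma> (\<Union>p\<in>F. E p) \<le> compact_capacity (\<Union>p\<in>F. E p)"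
    unfolding compact_capacity_def
    using fin zero pot by (intro SUP_upper) (auto simp: \<sigma>_def intro!: finite_measureI)
  with mass show ?thesis by (rule order_trans)
qed

section \<open>Signed measures that happen to be positive\<close>

lemma signed_borel_measure_measure:
  assumes N: "finite_measure N" "sets N = sets (borel :: complex measure)"
  shows "signed_borel_measure (measure N)"
  unfolding signed_borel_measure_def
  using finite_measure.finite_measure_UNION[OF N(1)] N(2) by auto

lemma pos_variation_measure:
  assumes N: "finite_measure N" "sets N = sets (borel :: complex measure)"
  shows "pos_variation (measure N) = N"
proof (rule measure_eqI)
  fix A assume "A \<in> sets (pos_variation (measure N))"
  then have A: "A \<in> sets borel" by simp
  have "(SUP B\<in>{B \<in> sets borel. B \<subseteq> A}. ennreal (measure N B)) = ennreal (measure N A)"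
  proof (rule antisym)
    show "(SUP B\<in>{B \<in> sets borel. B \<subseteq> A}. ennreal (measure N B)) \<le> ennreal (measure N A)"
      using A N by (intro SUP_least ennreal_leI finite_measure.finite_measure_mono) auto
  qed (use A in \<open>auto intro: SUP_upper\<close>)
  then show "emeasure (pos_variation (measure N)) A = emeasure N A"
    using A by (simp add: emeasure_pos_variation signed_borel_measure_measure[OF N]
        finite_measure.emeasure_eq_measure[OF N(1)])
qed (use N in simp)

lemma neg_variation_measure:
  assumes N: "finite_measure N" "sets N = sets (borel :: complex measure)"
  shows "neg_variation (measure N) = null_measure borel"
proof (rule measure_eqI)
  fix A assume "A \<in> sets (neg_variation (measure N))"
  then have A: "A \<in> sets borel" by simp
  have "emeasure (neg_variation (measure N)) A = (SUP B\<in>{B \<in> sets borel. B \<subseteq> A}. ennreal (- measure N B))"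
    unfolding neg_variation_def
    using A by (intro emeasure_pos_variation signed_borel_measure_uminus signed_borel_measure_measure N)
  also have "\<dots> = (SUP B\<in>{B \<in> sets borel. B \<subseteq> A}. 0)"
    by (intro SUP_cong refl) (simp add: ennreal_neg)
  also have "\<dots> = 0"
    by (rule SUP_eq_const) (auto intro: exI[of _ "{}"])
  finally show "emeasure (neg_variation (measure N)) A = emeasure (null_measure borel) A" by simp
qed simp

lemma sets_total_variation: "sets (total_variation \<nu>) = sets borel"
  unfolding total_variation_def
  by (simp add: sets.sigma_sets_eq[of "borel :: complex measure", simplified])

lemma total_variation_measure:
  assumes N: "finite_measure N" "sets N = sets (borel :: complex measure)"
  shows "total_variation (measure N) = N"
  by (rule measure_eqI)
    (use N in \<open>auto simp: sets_total_variation emeasure_total_variation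
        pos_variation_measure neg_variation_measure\<close>)

section \<open>Potentials of compactly supported measures\<close>

lemma e2ennreal_abs_le: "e2ennreal \<bar>x\<bar> \<le> e2ennreal x + e2ennreal (- x)"
  by (cases "0 \<le> x") (auto simp: e2ennreal_neg add_increasing add_increasing2)

lemma le_e2ennreal_abs: "e2ennreal x \<le> e2ennreal \<bar>x\<bar>" "e2ennreal (- x) \<le> e2ennreal \<bar>x\<bar>"
  by (intro e2ennreal_mono; cases x; simp)+

text \<open>
  On bounded sets the potential of a positive measure is bounded below.
\<close>

lemma neg_log_kernel_le:
  assumes "cmod z \<le> S" "cmod w \<le> R"
  shows "e2ennreal (- log_kernel z w) \<le> ennreal (S + R)"
proof (cases "z = w")
  case False
  have "cmod (z - w) \<le> S + R" using assms norm_triangle_ineq4[of z w] by simp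
  moreover have "ln (cmod (z - w)) \<le> cmod (z - w) - 1" using False by (intro ln_le_minus_one) simp
  ultimately have "- ln (1 / cmod (z - w)) \<le> S + R" using False by (simp add: ln_div)
  then show ?thesis using False by (simp add: log_kernel_def ennreal_leI)
qed (simp add: log_kernel_def e2ennreal_neg)

locale compactly_supported_measure = finite_measure N for N :: "complex measure" +
  fixes R :: real
  assumes sets_N [measurable_cong]: "sets N = sets borel"
    and R_pos: "R > 0"
    and support: "AE w in N. cmod w \<le> R"
begin

lemma measurable_potential_abs [measurable]:
  "(\<lambda>z. \<integral>\<^sup>+ w. e2ennreal \<bar>log_kernel z w\<bar> \<partial>N) \<in> borel_measurable borel"
proof -
  have "(\<lambda>x. e2ennreal \<bar>log_kernel (fst x) (snd x)\<bar>) \<in> borel_measurable (borel \<Otimes>\<^sub>M N)"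
    by measurable
  then show ?thesis
    using borel_measurable_nn_integral[of "\<lambda>z w. e2ennreal \<bar>log_kernel z w\<bar>" borel]
    by (simp add: case_prod_beta')
qed

abbreviation dom :: "complex set" where "dom \<equiv> log_potential_domain (measure N)"

lemma dom_eq: "dom = {z. (\<integral>\<^sup>+ w. e2ennreal \<bar>log_kernel z w\<bar> \<partial>N) < \<infinity>}"
  by (simp add: log_potential_domain_def total_variation_measure finite_measure_axioms sets_N)

lemma dom_borel [measurable]: "dom \<in> sets borel"
  unfolding dom_eq by measurable

text \<open>
  By Tonelli's theorem, since the kernel is locally integrable with respect to area.
\<close>

lemma AE_dom: "AE z in lborel. z \<in> dom"
proof -
  interpret P: pair_sigma_finite lborel N ..
  let ?G = "\<lambda>z. \<integral>\<^sup>+ w. e2ennreal \<bar>log_kernel z w\<bar> \<partial>N"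
  have "AE z in lborel. ?G z * indicator (cball 0 (real n)) z \<noteq> \<infinity>" for n
  proof (rule nn_integral_PInf_AE)
    let ?A = "cball 0 (real n) :: complex set"
    have [measurable]: "?A \<in> sets borel" by simp
    \<comment> \<open>In the variable \<open>z\<close> the kernel is locally integrable, uniformly in \<open>w\<close>.\<close>
    have inner: "(\<integral>\<^sup>+z. e2ennreal \<bar>log_kernel z w\<bar> * indicator ?A z \<partial>lborel)
         \<le> ennreal (2 * pi + (n + R) * (pi * (real n)\<^sup>2))" if w: "cmod w \<le> R" for w
    proof -
      have "(\<integral>\<^sup>+z. e2ennreal \<bar>log_kernel z w\<bar> * indicator ?A z \<partial>lborel)
          \<le> (\<integral>\<^sup>+z. e2ennreal (log_kernel w z) * indicator ?A z + ennreal (n + R) * indicator ?A z \<partial>lborel)"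
      proof (rule nn_integral_mono)
        fix z
        have "e2ennreal \<bar>log_kernel z w\<bar> \<le> e2ennreal (log_kernel w z) + ennreal (n + R)" if "cmod z \<le> n"
          using e2ennreal_abs_le[of "log_kernel z w"] neg_log_kernel_le[OF that w]
          unfolding log_kernel_sym[of z w] by (meson add_left_mono order_trans)
        then show "e2ennreal \<bar>log_kernel z w\<bar> * indicator ?A z
            \<le> e2ennreal (log_kernel w z) * indicator ?A z + ennreal (n + R) * indicator ?A z"
          by (auto simp: indicator_def)
      qed
      also have "\<dots> = (\<integral>\<^sup>+z\<in>?A. e2ennreal (log_kernel w z) \<partial>lborel) + ennreal (n + R) * emeasure lborel ?A"
        by (subst nn_integral_add) (auto simp: nn_integral_cmult_indicator)
      also have "\<dots> \<le> (ennreal (ln (1 / 1)) * emeasure lborel ?A + ennreal (2 * pi * 1\<^sup>2))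
           + ennreal (n + R) * emeasure lborel ?A"
        by (intro add_right_mono area_log_kernel_le) auto
      also have "\<dots> = ennreal (2 * pi + (n + R) * (pi * (real n)\<^sup>2))"
        using R_pos by (simp add: emeasure_lborel_cball_complex flip: ennreal_mult ennreal_plus)
      finally show ?thesis .
    qed
    have "(\<integral>\<^sup>+z. ?G z * indicator ?A z \<partial>lborel)
        = (\<integral>\<^sup>+z. (\<integral>\<^sup>+ w. e2ennreal \<bar>log_kernel z w\<bar> * indicator ?A z \<partial>N) \<partial>lborel)"
      by (intro nn_integral_cong nn_integral_multc[symmetric]) measurable
    also have "\<dots> = (\<integral>\<^sup>+w. (\<integral>\<^sup>+ z. e2ennreal \<bar>log_kernel z w\<bar> * indicator ?A z \<partial>lborel) \<partial>N)"
    proof (rule P.Fubini'[symmetric])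
      show "(\<lambda>(z, w). e2ennreal \<bar>log_kernel z w\<bar> * indicator ?A z) \<in> borel_measurable (lborel \<Otimes>\<^sub>M N)"
        unfolding case_prod_beta' by measurable
    qed
    also have "\<dots> \<le> (\<integral>\<^sup>+w. ennreal (2 * pi + (n + R) * (pi * (real n)\<^sup>2)) \<partial>N)"
      by (rule nn_integral_mono_AE) (use support inner in \<open>auto elim: eventually_mono\<close>)
    also have "\<dots> < \<infinity>"
      by (simp add: emeasure_eq_measure ennreal_mult_less_top)
    finally show "(\<integral>\<^sup>+z. ?G z * indicator ?A z \<partial>lborel) \<noteq> \<infinity>" by simp
  next
    show "(\<lambda>z. ?G z * indicator (cball 0 (real n)) z) \<in> borel_measurable lborel"
      using borel_measurable_times_ennreal[OF measurable_potential_abs borel_measurable_indicator[of "cball 0 (real n)"]]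
      by simp
  qed
  then have "AE z in lborel. \<forall>n. ?G z * indicator (cball 0 (real n)) z \<noteq> \<infinity>"
    by (simp add: AE_all_countable)
  then show ?thesis
  proof eventually_elim
    case (elim z)
    obtain n where "cmod z \<le> real n" using real_arch_simple by blast
    then show ?case using spec[OF elim, of n] by (simp add: dom_eq less_top)
  qed
qed

lemma compact_subset_dom:
  assumes "\<rho> > 0"
  obtains E where "compact E" "E \<subseteq> cball p \<rho> \<inter> dom" "ennreal (pi * \<rho>\<^sup>2 / 2) \<le> emeasure lborel E"
proof -
  let ?S = "cball p \<rho> \<inter> dom"
  have e: "pi * \<rho>\<^sup>2 / 2 > 0" using assms by simp
  have S: "?S \<in> sets borel" by simp
  have area: "emeasure lborel ?S = ennreal (pi * \<rho>\<^sup>2)"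
  proof -
    have "emeasure lborel ?S = emeasure lborel (cball p \<rho>)"
      using AE_dom S by (intro emeasure_eq_AE) auto
    then show ?thesis using assms by (simp add: emeasure_lborel_cball_complex)
  qed
  obtain E where E: "closed E" "E \<subseteq> ?S" "emeasure lebesgue (?S - E) < ennreal (pi * \<rho>\<^sup>2 / 2)"
    using sets_lebesgue_inner_closed[OF _ e, of ?S] S by (metis sets_completionI_sets sets_lborel)
  have Eb: "E \<in> sets borel" using E by (simp add: borel_closed)
  have "compact E" using E by (meson bounded_cball bounded_subset compact_eq_bounded_closed le_inf_iff)
  moreover have "ennreal (pi * \<rho>\<^sup>2 / 2) \<le> emeasure lborel E"
  proof -
    have "ennreal (pi * \<rho>\<^sup>2) = emeasure lborel (?S - E) + emeasure lborel E"
      using E S Eb by (subst plus_emeasure) (auto simp: area Un_absorb2)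
    also have "\<dots> \<le> ennreal (pi * \<rho>\<^sup>2 / 2) + emeasure lborel E"
      using E S Eb by (intro add_right_mono) (simp add: less_imp_le)
    finally have le: "ennreal (pi * \<rho>\<^sup>2 / 2) + ennreal (pi * \<rho>\<^sup>2 / 2) \<le> ennreal (pi * \<rho>\<^sup>2 / 2) + emeasure lborel E"
      using e by (simp flip: ennreal_plus)
    then show ?thesis by (simp add: ennreal_add_left_cancel_le)
  qed
  ultimately show ?thesis using that E by blast
qed

lemma log_potential_eq:
  assumes "z \<in> dom"
  shows "log_potential (measure N) z
    = enn2real (\<integral>\<^sup>+ w. e2ennreal (log_kernel z w) \<partial>N) - enn2real (\<integral>\<^sup>+ w. e2ennreal (- log_kernel z w) \<partial>N)"
proof -
  let ?P = "\<integral>\<^sup>+ w. e2ennreal (log_kernel z w) \<partial>N" and ?Q = "\<integral>\<^sup>+ w. e2ennreal (- log_kernel z w) \<partial>N"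
  have le: "?P \<le> (\<integral>\<^sup>+ w. e2ennreal \<bar>log_kernel z w\<bar> \<partial>N)" "?Q \<le> (\<integral>\<^sup>+ w. e2ennreal \<bar>log_kernel z w\<bar> \<partial>N)"
    by (intro nn_integral_mono le_e2ennreal_abs)+
  have "?P < \<infinity>" "?Q < \<infinity>" using le assms by (auto simp: dom_eq)
  then have "enn2ereal ?P = ereal (enn2real ?P)" "enn2ereal ?Q = ereal (enn2real ?Q)"
    by (simp_all add: enn2ereal_ennreal less_top[symmetric] flip: enn2ereal_ennreal)
  then show ?thesis
    by (simp add: log_potential_def pos_variation_measure neg_variation_measure
        finite_measure_axioms sets_N pos_log_potential_def zero_ennreal.rep_eq)
qed

lemma log_potential_ge_atom:
  assumes z: "z \<in> dom" "cmod z \<le> S" "z \<noteq> p"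
  shows "measure N {p} * ln (1 / cmod (z - p)) - measure N UNIV * (S + R) \<le> log_potential (measure N) z"
proof -
  let ?P = "\<integral>\<^sup>+ w. e2ennreal (log_kernel z w) \<partial>N" and ?Q = "\<integral>\<^sup>+ w. e2ennreal (- log_kernel z w) \<partial>N"
  have sp: "space N = UNIV" using sets_eq_imp_space_eq[OF sets_N] by simp
  have le: "?P \<le> (\<integral>\<^sup>+ w. e2ennreal \<bar>log_kernel z w\<bar> \<partial>N)" "?Q \<le> (\<integral>\<^sup>+ w. e2ennreal \<bar>log_kernel z w\<bar> \<partial>N)"
    by (intro nn_integral_mono le_e2ennreal_abs)+
  have fin: "?P < \<infinity>" "?Q < \<infinity>" using le z by (auto simp: dom_eq)
  have S0: "S + R \<ge> 0" using z R_pos norm_ge_zero[of z] by linarith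
  have "?Q \<le> (\<integral>\<^sup>+ w. ennreal (S + R) \<partial>N)"
    by (rule nn_integral_mono_AE) (use support neg_log_kernel_le[OF z(2)] in \<open>auto elim: eventually_mono\<close>)
  also have "\<dots> = ennreal (measure N UNIV * (S + R))"
    using S0 by (simp add: sp emeasure_eq_measure ennreal_mult mult.commute)
  finally have Q: "enn2real ?Q \<le> measure N UNIV * (S + R)"
    using S0 by (intro enn2real_leI) auto
  have "ennreal (ln (1 / cmod (z - p))) * emeasure N {p}
      = (\<integral>\<^sup>+ w. ennreal (ln (1 / cmod (z - p))) * indicator {p} w \<partial>N)"
    by (rule nn_integral_cmult_indicator[symmetric]) (simp add: sets_N)
  also have "\<dots> \<le> ?P"
    using z by (intro nn_integral_mono) (auto simp: indicator_def log_kernel_def)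
  finally have "ennreal (ln (1 / cmod (z - p)) * measure N {p}) \<le> ?P"
    by (simp add: emeasure_eq_measure ennreal_mult'')
  also have "?P = ennreal (enn2real ?P)" using fin by simp
  finally have "ln (1 / cmod (z - p)) * measure N {p} \<le> enn2real ?P"
    by (simp add: ennreal_le_iff)
  then show ?thesis using Q log_potential_eq[OF z(1)] by (simp add: mult.commute)
qed

end

section \<open>Atoms near a point obstruct differentiability\<close>

lemma ennreal_inverse_antimono: "x \<le> y \<Longrightarrow> inverse y \<le> inverse (x :: ennreal)"
  including ennreal.lifting
  by transfer (auto intro: ereal_inverse_antimono)

lemma finite_pos_lower_bound:
  assumes "finite X" "\<And>x. x \<in> X \<Longrightarrow> 0 < (f x :: real)"
  shows "\<exists>\<delta>>0. \<forall>x\<in>X. \<delta> \<le> f x"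
proof (intro exI[of _ "Min (insert 1 (f ` X))"] conjI ballI)
  show "0 < Min (insert 1 (f ` X))" using assms by (subst Min_gr_iff) auto
  show "Min (insert 1 (f ` X)) \<le> f x" if "x \<in> X" for x using assms that by (intro Min_le) auto
qed

context compactly_supported_measure
begin

definition diff_quot :: "real \<Rightarrow> real \<Rightarrow> complex \<Rightarrow> complex \<Rightarrow> real" where
  "diff_quot A1 A2 a x = \<bar>log_potential (measure N) x - log_potential (measure N) a
      - (A1 * (Re x - Re a) + A2 * (Im x - Im a))\<bar> / cmod (x - a)"

text \<open>
  With \<open>d = |p - a|\<close> and \<open>m = \<nu>{p}\<close>, on the disc of radius \<open>exp (- 3 t d / m)\<close> about \<open>p\<close> the atom alone
  contributes at least \<open>3 t d\<close> to the potential. For large \<open>t\<close> one third of this absorbs the constant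
  \<open>C\<close> formed from all other terms of the quotient, and \<open>|x - a| \<le> 2 d\<close> uses up the remaining two.
\<close>

lemma eventually_diff_quot_gt:
  assumes p: "p \<noteq> a" "measure N {p} > 0"
  shows "\<forall>\<^sub>F t in at_top. \<forall>x \<in> dom \<inter> cball p (exp (- (3 * t * cmod (p - a) / measure N {p}))).
            diff_quot A1 A2 a x > t"
proof -
  define d where "d = cmod (p - a)"
  define m where "m = measure N {p}"
  define S where "S = cmod a + 2 * d"
  define C where "C = measure N UNIV * (S + R) + \<bar>log_potential (measure N) a\<bar> + (\<bar>A1\<bar> + \<bar>A2\<bar>) * (2 * d)"
  have d: "d > 0" and m: "m > 0" using p by (auto simp: d_def m_def)
  have "\<forall>\<^sub>F t in at_top. t > 0 \<and> t > C / d \<and> t \<ge> m * ln (1 / d) / (3 * d)"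
    by (intro eventually_conj eventually_gt_at_top eventually_ge_at_top)
  then show ?thesis
  proof eventually_elim
    case (elim t)
    define \<rho> where "\<rho> = exp (- (3 * t * d / m))"
    have tC: "C < t * d" using elim d by (simp add: field_simps)
    have "ln (1 / d) \<le> 3 * t * d / m" using elim d m by (simp add: field_simps)
    then have "- (3 * t * d / m) \<le> ln d" using d by (simp add: ln_div)
    then have \<rho>d: "\<rho> \<le> d" unfolding \<rho>_def using d by (metis exp_le_cancel_iff exp_ln)
    have "diff_quot A1 A2 a x > t" if x: "x \<in> dom" "x \<in> cball p \<rho>" for x
    proof -
      have xp: "cmod (x - p) \<le> \<rho>" using x by (simp add: dist_norm norm_minus_commute)
      \<comment> \<open>An atom lies outside the domain, as the kernel is infinite there.\<close>
      have ne: "x \<noteq> p"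
      proof
        assume "x = p"
        have "\<infinity> * emeasure N {p} = (\<integral>\<^sup>+ w. \<infinity> * indicator {p} w \<partial>N)"
          by (rule nn_integral_cmult_indicator[symmetric]) (simp add: sets_N)
        also have "\<dots> \<le> (\<integral>\<^sup>+ w. e2ennreal \<bar>log_kernel p w\<bar> \<partial>N)"
          by (intro nn_integral_mono) (auto simp: indicator_def log_kernel_def)
        finally have "(\<infinity>::ennreal) \<le> (\<integral>\<^sup>+ w. e2ennreal \<bar>log_kernel p w\<bar> \<partial>N)"
          using m by (simp add: emeasure_eq_measure m_def ennreal_top_mult top_unique)
        then show False using x \<open>x = p\<close> by (simp add: dom_eq top_unique)
      qed
      have xa: "cmod (x - a) \<le> 2 * d"
        using norm_triangle_ineq[of "x - p" "p - a"] xp \<rho>d by (simp add: d_def)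
      then have xS: "cmod x \<le> S"
        using norm_triangle_ineq[of "x - a" a] by (simp add: S_def)
      \<comment> \<open>At \<open>x = a\<close> the quotient would be \<open>0 / 0 = 0\<close>; but \<open>a\<close> is in the disc only if \<open>\<rho> = d\<close>, and then the
      potential at \<open>a\<close> would exceed its own value.\<close>
      have nea: "x \<noteq> a"
      proof
        assume "x = a"
        then have eq: "cmod (x - p) = d" by (simp add: d_def norm_minus_commute)
        have "log_potential (measure N) x \<ge> m * ln (1 / d) - measure N UNIV * (S + R)"
          using log_potential_ge_atom[OF x(1) xS ne] eq by (simp add: m_def)
        moreover have "m * ln (1 / d) \<ge> 3 * t * d"
        proof -
          have "d \<le> \<rho>" using xp eq by simp
          then have "ln d \<le> ln \<rho>" using d by simp
          then have "3 * t * d / m \<le> ln (1 / d)" using d by (simp add: \<rho>_def ln_div)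
          then show ?thesis using m by (simp add: field_simps)
        qed
        moreover have "C \<ge> measure N UNIV * (S + R) + \<bar>log_potential (measure N) x\<bar>"
          using d \<open>x = a\<close> by (simp add: C_def)
        ultimately have "3 * t * d \<le> C" by linarith
        moreover have "t * d > 0" using elim d by simp
        ultimately show False using tC by simp
      qed
      have "3 * t * d / m = ln (1 / \<rho>)" by (simp add: \<rho>_def ln_div)
      also have "\<dots> \<le> ln (1 / cmod (x - p))"
        using xp ne by (subst ln_le_cancel_iff) (auto simp: \<rho>_def frac_le)
      finally have "3 * t * d \<le> m * ln (1 / cmod (x - p))" using m by (simp add: field_simps)
      then have u: "3 * t * d - measure N UNIV * (S + R) \<le> log_potential (measure N) x"
        using log_potential_ge_atom[OF x(1) xS ne] by (simp add: m_def)
      have "\<bar>A1 * (Re x - Re a)\<bar> \<le> \<bar>A1\<bar> * (2 * d)" "\<bar>A2 * (Im x - Im a)\<bar> \<le> \<bar>A2\<bar> * (2 * d)"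
        using abs_Re_le_cmod[of "x - a"] abs_Im_le_cmod[of "x - a"] xa
        by (auto simp: abs_mult intro!: mult_left_mono)
      then have "\<bar>log_potential (measure N) x - log_potential (measure N) a
          - (A1 * (Re x - Re a) + A2 * (Im x - Im a))\<bar> \<ge> 3 * t * d - C"
        using u unfolding C_def by (simp add: algebra_simps)
      moreover have "t * cmod (x - a) \<le> t * (2 * d)" using xa elim by (intro mult_left_mono) auto
      ultimately have "t * cmod (x - a) < \<bar>log_potential (measure N) x - log_potential (measure N) a
          - (A1 * (Re x - Re a) + A2 * (Im x - Im a))\<bar>" using tC by linarith
      then show ?thesis using nea by (simp add: diff_quot_def field_simps)
    qed
    then show ?case by (auto simp: \<rho>_def d_def m_def)
  qed
qed

text \<open>
  For \<open>t\<close> large enough all discs of \<open>eventually_diff_quot_gt\<close> lie in the ball, are tiny compared with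
  their separation \<open>\<delta>\<close>, and carry test masses \<open>\<alpha> p = m p / (10 t d p)\<close>. The factor \<open>t\<close> in the
  supremum then cancels the \<open>t\<close> in the total mass.
\<close>

lemma sup_capacity_ge:
  assumes F: "finite F" "F \<subseteq> ball a r - {a}" "\<And>p. p \<in> F \<Longrightarrow> measure N {p} > 0"
  shows "ennreal ((\<Sum>p\<in>F. measure N {p} / cmod (p - a)) / 20) \<le>
    (SUP t\<in>{0<..}. ennreal t * capacity {x \<in> ball a r. x \<in> dom \<and> diff_quot A1 A2 a x > t})"
proof -
  define m where "m p = measure N {p}" for p
  define d where "d p = cmod (p - a)" for p
  have d: "d p > 0" and m: "m p > 0" if "p \<in> F" for p using F that by (auto simp: d_def m_def)
  have "finite {x \<in> F \<times> F. fst x \<noteq> snd x}" using F(1) by simp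
  from finite_pos_lower_bound[OF this, of "\<lambda>x. dist (fst x) (snd x)"]
  obtain \<delta>1 where \<delta>1: "0 < \<delta>1" "\<And>p q. p \<in> F \<Longrightarrow> q \<in> F \<Longrightarrow> p \<noteq> q \<Longrightarrow> \<delta>1 \<le> dist p q"
    by auto
  have "0 < r - dist a p" if "p \<in> F" for p using F(2) that by auto
  then have "\<exists>\<delta>>0. \<forall>p\<in>F. \<delta> \<le> r - dist a p" by (intro finite_pos_lower_bound F(1))
  then
  obtain \<delta>2 where \<delta>2: "0 < \<delta>2" "\<And>p. p \<in> F \<Longrightarrow> \<delta>2 \<le> r - dist a p"
    by auto
  define \<delta> where "\<delta> = min 1 (min (\<delta>1 / 4) (\<delta>2 / 2))"
  have \<delta>: "0 < \<delta>" "\<delta> \<le> 1" "4 * \<delta> \<le> \<delta>1" "\<delta> < \<delta>2"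
    using \<delta>1 \<delta>2 by (auto simp: \<delta>_def)
  define L where "L = (\<Sum>p\<in>F. m p / d p)"
  have "\<forall>\<^sub>F t in at_top. \<forall>p\<in>F. (\<forall>x \<in> dom \<inter> cball p (exp (- (3 * t * d p / m p))). diff_quot A1 A2 a x > t)
      \<and> t \<ge> m p / d p \<and> t \<ge> m p * ln (1 / \<delta>) / (3 * d p)"
  proof (rule eventually_ball_finite[OF F(1)], intro ballI eventually_conj)
    fix p assume "p \<in> F"
    then show "\<forall>\<^sub>F t in at_top. \<forall>x \<in> dom \<inter> cball p (exp (- (3 * t * d p / m p))). diff_quot A1 A2 a x > t"
      using F unfolding d_def m_def by (intro eventually_diff_quot_gt) auto
  qed (rule eventually_ge_at_top)+
  moreover have "\<forall>\<^sub>F t in at_top. t > (0::real)" by (rule eventually_gt_at_top)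
  moreover have "\<forall>\<^sub>F t in at_top. t \<ge> ln (1 / \<delta>) * L / 5" by (rule eventually_ge_at_top)
  ultimately have "\<forall>\<^sub>F t in at_top. t > 0 \<and> t \<ge> ln (1 / \<delta>) * L / 5 \<and>
      (\<forall>p\<in>F. (\<forall>x \<in> dom \<inter> cball p (exp (- (3 * t * d p / m p))). diff_quot A1 A2 a x > t)
      \<and> t \<ge> m p / d p \<and> t \<ge> m p * ln (1 / \<delta>) / (3 * d p))"
    by eventually_elim blast
  from eventually_happens'[OF trivial_limit_at_top_linorder this]
  obtain t where *: "t > 0 \<and> t \<ge> ln (1 / \<delta>) * L / 5 \<and>
      (\<forall>p\<in>F. (\<forall>x \<in> dom \<inter> cball p (exp (- (3 * t * d p / m p))). diff_quot A1 A2 a x > t)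
      \<and> t \<ge> m p / d p \<and> t \<ge> m p * ln (1 / \<delta>) / (3 * d p))" ..
  then have t: "t > 0" "t \<ge> ln (1 / \<delta>) * L / 5" by simp_all
  have tp: "t \<ge> m p / d p" "t \<ge> m p * ln (1 / \<delta>) / (3 * d p)" if "p \<in> F" for p
    using * that by simp_all
  have quot: "diff_quot A1 A2 a x > t"
    if "p \<in> F" "x \<in> dom" "x \<in> cball p (exp (- (3 * t * d p / m p)))" for p x
    using *[THEN conjunct2, THEN conjunct2, THEN bspec, OF that(1)] that(2,3) by blast
  define \<rho> where "\<rho> p = exp (- (3 * t * d p / m p))" for p
  define \<alpha> where "\<alpha> p = m p / (10 * t * d p)" for p
  have "\<exists>E. compact E \<and> E \<subseteq> cball p (\<rho> p) \<inter> dom \<and> ennreal (pi * (\<rho> p)\<^sup>2 / 2) \<le> emeasure lborel E" for p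
    by (rule compact_subset_dom[of "\<rho> p" p]) (simp add: \<rho>_def, blast)
  then obtain E where E: "\<And>p. compact (E p)" "\<And>p. E p \<subseteq> cball p (\<rho> p) \<inter> dom"
      "\<And>p. ennreal (pi * (\<rho> p)\<^sup>2 / 2) \<le> emeasure lborel (E p)"
    by metis
  have \<rho>: "0 < \<rho> p \<and> \<rho> p \<le> \<delta>" if "p \<in> F" for p
  proof -
    have "ln (1 / \<delta>) \<le> 3 * t * d p / m p" using tp(2)[OF that] d[OF that] m[OF that] by (simp add: field_simps)
    then have "- (3 * t * d p / m p) \<le> ln \<delta>" using \<delta> by (simp add: ln_div)
    then show ?thesis unfolding \<rho>_def using \<delta> by (metis exp_gt_zero exp_le_cancel_iff exp_ln)
  qed
  have \<Sigma>: "(\<Sum>p\<in>F. \<alpha> p) = L / (10 * t)"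
    by (simp add: L_def \<alpha>_def sum_divide_distrib mult.commute mult.left_commute)
  have cap: "ennreal ((\<Sum>p\<in>F. \<alpha> p) / 2) \<le> compact_capacity (\<Union>p\<in>F. E p)"
  proof (rule compact_capacity_discs_ge[OF F(1) \<delta>(1,2)])
    show "4 * \<delta> \<le> dist p q" if "p \<in> F" "q \<in> F" "p \<noteq> q" for p q
      using \<delta>1(2)[OF that] \<delta> by linarith
    show "0 \<le> \<alpha> p" if "p \<in> F" for p using d[OF that] m[OF that] t by (simp add: \<alpha>_def)
    show "\<alpha> p * (ln (1 / \<rho> p) + 2) \<le> 1 / 2" if "p \<in> F" for p
    proof -
      have "ln (1 / \<rho> p) = 3 * t * d p / m p" by (simp add: \<rho>_def ln_div)
      then have "\<alpha> p * (ln (1 / \<rho> p) + 2) = 3 / 10 + m p / d p / (5 * t)"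
        using d[OF that] m[OF that] t by (simp add: \<alpha>_def field_simps)
      also have "m p / d p / (5 * t) \<le> t / (5 * t)"
        using tp(1)[OF that] t by (intro divide_right_mono) auto
      finally show ?thesis using t by simp
    qed
    show "ln (1 / \<delta>) * (\<Sum>p\<in>F. \<alpha> p) \<le> 1 / 2"
      using t unfolding \<Sigma> by (simp add: field_simps)
  qed (use \<rho> E in auto)
  have sub: "(\<Union>p\<in>F. E p) \<subseteq> {x \<in> ball a r. x \<in> dom \<and> diff_quot A1 A2 a x > t}"
  proof
    fix x assume "x \<in> (\<Union>p\<in>F. E p)"
    then obtain p where p: "p \<in> F" "x \<in> E p" by blast
    then have x: "x \<in> dom" "x \<in> cball p (\<rho> p)" using E(2)[of p] by blast+
    have "dist a x < r" using x(2) \<rho>[OF p(1)] \<delta> \<delta>2(2)[OF p(1)] dist_triangle[of a x p] by simp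
    then show "x \<in> {x \<in> ball a r. x \<in> dom \<and> diff_quot A1 A2 a x > t}"
      using x quot[OF p(1), of x] by (simp add: \<rho>_def)
  qed
  have "ennreal (L / 20) = ennreal t * ennreal ((\<Sum>p\<in>F. \<alpha> p) / 2)"
    using t by (simp add: \<Sigma> flip: ennreal_mult')
  also have "\<dots> \<le> ennreal t * capacity {x \<in> ball a r. x \<in> dom \<and> diff_quot A1 A2 a x > t}"
    using cap compact_capacity_le_capacity[OF sub] F(1) E(1)
    by (intro mult_left_mono) (auto intro: order_trans)
  finally show ?thesis
    unfolding L_def m_def d_def using t by (intro SUP_upper2[of t]) auto
qed

text \<open>
  At each radius \<open>r k\<close> the quotient in the definition is at least \<open>c / 20\<close>: the numerator is bounded
  by \<open>sup_capacity_ge\<close>, after points of mass zero have been discarded from \<open>F k\<close>, and the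
  denominator by \<open>capacity_ball_le\<close>.
\<close>

theorem not_capacity_differentiable:
  assumes c: "c > 0" and r: "r \<longlonglongrightarrow> 0" "\<And>k. 0 < r k" "\<And>k. r k < 1"
    and F: "\<And>k. finite (F k)" "\<And>k. F k \<subseteq> ball a (r k) - {a}"
    and big: "\<And>k. c \<le> ln (1 / r k) * (\<Sum>p\<in>F k. measure N {p} / cmod (p - a))"
  shows "\<not> capacity_differentiable dom (log_potential (measure N)) a"
proof
  assume "capacity_differentiable dom (log_potential (measure N)) a"
  then obtain A1 A2 where lim: "((\<lambda>r. (SUP t\<in>{0<..}. ennreal t * capacity {x \<in> ball a r. x \<in> dom \<and> diff_quot A1 A2 a x > t})
                  / capacity (ball a r)) \<longlongrightarrow> 0) (at_right 0)"
    unfolding capacity_differentiable_def Let_def diff_quot_def by blast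
  define V where "V r = (SUP t\<in>{0<..}. ennreal t * capacity {x \<in> ball a r. x \<in> dom \<and> diff_quot A1 A2 a x > t})" for r
  have "filterlim r (at_right 0) sequentially"
    using r by (intro tendsto_imp_filterlim_at_right) auto
  from filterlim_compose[OF lim this] have "(\<lambda>k. V (r k) / capacity (ball a (r k))) \<longlonglongrightarrow> 0"
    by (simp add: V_def)
  then have "\<forall>\<^sub>F k in sequentially. V (r k) / capacity (ball a (r k)) < ennreal (c / 20)"
    using c by (intro order_tendstoD) auto
  then obtain k where k: "V (r k) / capacity (ball a (r k)) < ennreal (c / 20)"
    using eventually_happens trivial_limit_sequentially by blast
  define F' where "F' = {p \<in> F k. measure N {p} > 0}"
  define W where "W = (\<Sum>p\<in>F k. measure N {p} / cmod (p - a))"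
  have l: "ln (1 / r k) > 0" using r by simp
  have "W = (\<Sum>p\<in>F'. measure N {p} / cmod (p - a))"
    unfolding F'_def W_def using F(1) measure_nonneg[of N]
    by (intro sum.mono_neutral_right) (auto simp: order_less_le)
  moreover have "ennreal ((\<Sum>p\<in>F'. measure N {p} / cmod (p - a)) / 20) \<le> V (r k)"
    unfolding V_def using F by (intro sup_capacity_ge) (auto simp: F'_def)
  ultimately have "ennreal (W / 20) \<le> V (r k)" by simp
  then have "ennreal (W / 20) * ennreal (ln (1 / r k)) \<le> V (r k) * inverse (capacity (ball a (r k)))"
  proof (rule mult_mono)
    have "inverse (ennreal (1 / ln (1 / r k))) \<le> inverse (capacity (ball a (r k)))"
      using capacity_ball_le[OF r(2,3), of a k]
      by (rule ennreal_inverse_antimono)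
    then show "ennreal (ln (1 / r k)) \<le> inverse (capacity (ball a (r k)))"
      using l by (simp add: inverse_ennreal)
  qed auto
  also have "\<dots> < ennreal (c / 20)" using k by (simp add: divide_ennreal_def)
  also have "ennreal (W / 20) * ennreal (ln (1 / r k)) = ennreal (W / 20 * ln (1 / r k))"
    using l by (rule ennreal_mult''[symmetric, OF less_imp_le])
  finally have "W / 20 * ln (1 / r k) < c / 20" by (meson ennreal_leI not_le)
  then show False using big[of k] by (simp add: W_def[symmetric] mult.commute)
qed

end

section \<open>Corner Cantor sets\<close>

fun digit :: "bool \<times> bool \<Rightarrow> complex" where
  "digit (b, c) = Complex (of_bool b) (of_bool c)"

abbreviation words :: "nat \<Rightarrow> (bool \<times> bool) list set" where
  "words m \<equiv> {v. length v = m}"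

lemma finite_words: "finite (words m)"
  using finite_lists_length_eq[of "UNIV :: (bool \<times> bool) set" m] by simp

lemma card_words: "card (words m) = 4 ^ m"
  using card_lists_length_eq[of "UNIV :: (bool \<times> bool) set" m] by simp

text \<open>
  The condition on the side lengths lets four squares of side \<open>s (Suc n)\<close> sit in the corners of a
  square of side \<open>s n\<close> without overlapping interiors.
\<close>

locale cantor_scales =
  fixes s :: "nat \<Rightarrow> real"
  assumes s_pos: "s n > 0" and s_half: "2 * s (Suc n) \<le> s n"
begin

lemma s_Suc_le: "s (Suc n) \<le> s n"
  using s_half[of n] s_pos[of "Suc n"] by simp

lemma s_antimono: "m \<le> n \<Longrightarrow> s n \<le> s m"
  by (rule lift_Suc_antimono_le[of s]) (rule s_Suc_le)

lemma s_le_power: "s n \<le> s 0 / 2 ^ n"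
proof (induction n)
  case (Suc n)
  have "s (Suc n) \<le> s n / 2" using s_half[of n] by simp
  also have "\<dots> \<le> s 0 / 2 ^ n / 2" using Suc by (intro divide_right_mono) auto
  finally show ?case by (simp add: field_simps)
qed simp

lemma s_tendsto_0: "s \<longlonglongrightarrow> 0"
proof (rule tendsto_sandwich[of "\<lambda>_. 0"])
  have "(\<lambda>n. s 0 * (1/2) ^ n) \<longlonglongrightarrow> s 0 * 0"
    by (intro tendsto_intros LIMSEQ_power_zero) simp
  then show "(\<lambda>n. s 0 / 2 ^ n) \<longlonglongrightarrow> 0" by (simp add: power_divide)
qed (use s_le_power s_pos in \<open>auto simp: less_imp_le\<close>)

text \<open>
  The lower left corner of the square with address \<open>v\<close>, when the construction is started at
  generation \<open>n\<close> with a square at the origin. Keeping the starting generation as a parameter makes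
  the set self-similar under removal of the first letter of an address.
\<close>

fun corner :: "nat \<Rightarrow> (bool \<times> bool) list \<Rightarrow> complex" where
  "corner n [] = 0"
| "corner n (d # v) = of_real (s n - s (Suc n)) * digit d + corner (Suc n) v"

definition square :: "nat \<Rightarrow> (bool \<times> bool) list \<Rightarrow> complex set" where
  "square n v = (let h = s (n + length v) in cbox (corner n v) (corner n v + Complex h h))"

lemma mem_square:
  "a \<in> square n v \<longleftrightarrow> Re (corner n v) \<le> Re a \<and> Re a \<le> Re (corner n v) + s (n + length v) \<and>
     Im (corner n v) \<le> Im a \<and> Im a \<le> Im (corner n v) + s (n + length v)"
  by (auto simp: square_def Let_def in_cbox_complex_iff)

lemma corner_append: "corner n (v @ w) = corner n v + corner (n + length v) w"
  by (induction v arbitrary: n) auto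

lemma corner_bounds:
  "0 \<le> Re (corner n v) \<and> Re (corner n v) \<le> s n - s (n + length v) \<and>
   0 \<le> Im (corner n v) \<and> Im (corner n v) \<le> s n - s (n + length v)"
proof (induction v arbitrary: n)
  case (Cons d v)
  obtain b c where d: "d = (b, c)" by fastforce
  show ?case using Cons[of "Suc n"] s_Suc_le[of n] by (auto simp: d)
qed simp

lemma square_append_subset: "square n (v @ w) \<subseteq> square n v"
proof
  fix a assume "a \<in> square n (v @ w)"
  then show "a \<in> square n v"
    using corner_bounds[of "n + length v" w] by (auto simp: mem_square corner_append add.assoc)
qed

text \<open>
  At the first letter where the addresses differ, one coordinate differs by \<open>s k - s (Suc k)\<close>, and
  the later letters can undo at most \<open>s (Suc k)\<close> minus the final side length.
\<close>

lemma corner_separated: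
  assumes "length v = length w" "v \<noteq> w"
  shows "s (n + length v) \<le> \<bar>Re (corner n v) - Re (corner n w)\<bar> \<or>
         s (n + length v) \<le> \<bar>Im (corner n v) - Im (corner n w)\<bar>"
  using assms
proof (induction v w arbitrary: n rule: list_induct2)
  case (Cons d v e w)
  obtain b c b' c' where d: "d = (b, c)" and e: "e = (b', c')" by fastforce
  show ?case
  proof (cases "d = e")
    case True
    then show ?thesis using Cons(2)[of "Suc n"] Cons(3) by simp
  next
    case False
    let ?h = "s (n + length (d # v))"
    have apart: "?h \<le> \<bar>(s n - s (Suc n)) * of_bool p + x - ((s n - s (Suc n)) * of_bool q + y)\<bar>"
      if "p \<noteq> q" "0 \<le> x \<and> x \<le> s (Suc n) - ?h" "0 \<le> y \<and> y \<le> s (Suc n) - ?h" for p q x y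
      using that s_half[of n] by (cases p; cases q) auto
    have len: "n + length (d # v) = Suc n + length v" "n + length (d # v) = Suc n + length w"
      using Cons(1) by auto
    have "b \<noteq> b' \<or> c \<noteq> c'" using False by (simp add: d e)
    then show ?thesis
    proof
      assume "b \<noteq> b'"
      then have "?h \<le> \<bar>Re (corner n (d # v)) - Re (corner n (e # w))\<bar>"
        using apart[of b b' "Re (corner (Suc n) v)" "Re (corner (Suc n) w)"]
          corner_bounds[of "Suc n" v] corner_bounds[of "Suc n" w]
        unfolding len[symmetric] by (simp add: d e)
      then show ?thesis ..
    next
      assume "c \<noteq> c'"
      then have "?h \<le> \<bar>Im (corner n (d # v)) - Im (corner n (e # w))\<bar>"
        using apart[of c c' "Im (corner (Suc n) v)" "Im (corner (Suc n) w)"]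
          corner_bounds[of "Suc n" v] corner_bounds[of "Suc n" w]
        unfolding len[symmetric] by (simp add: d e)
      then show ?thesis ..
    qed
  qed
qed simp

lemma inj_on_corner: "inj_on (corner n) (words m)"
proof (rule inj_onI)
  fix v w assume "v \<in> words m" "w \<in> words m" "corner n v = corner n w"
  then show "v = w" using corner_separated[of v w n] s_pos[of "n + m"] by auto
qed

definition cantor :: "complex set" where
  "cantor = (\<Inter>m. \<Union>v\<in>words m. square 0 v)"

lemma compact_cantor: "compact cantor"
proof -
  have "compact (\<Union>v\<in>words m. square 0 v)" for m
    by (intro compact_UN finite_words) (simp add: square_def Let_def compact_cbox)
  then show ?thesis unfolding cantor_def by (intro compact_Inter) auto
qed

text \<open>
  Continuing an address by lower left corners does not move the corner.
\<close>

lemma corner_in_cantor: "corner 0 v \<in> cantor"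
  unfolding cantor_def
proof
  fix m
  have zeros: "corner n (replicate k (False, False)) = 0" for n k
    by (induction k arbitrary: n) (auto simp: zero_complex.code)
  define u where "u = v @ replicate m (False, False)"
  have u: "corner 0 u = corner 0 v" by (simp add: u_def corner_append zeros)
  have "corner 0 u \<in> square 0 u" using s_pos[of "length u"] by (simp add: mem_square)
  then have "corner 0 v \<in> square 0 (take m u @ drop m u)" by (simp add: u)
  then have "corner 0 v \<in> square 0 (take m u)" using square_append_subset by blast
  moreover have "take m u \<in> words m" by (simp add: u_def)
  ultimately show "corner 0 v \<in> (\<Union>v\<in>words m. square 0 v)" by blast
qed

text \<open>
  Let \<open>m\<close> be the length of the address without its first letter. The three squares of the next
  generation with a different first letter hold \<open>3 * 4 ^ m\<close> of the corners, all within \<open>2 * s n\<close> of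
  \<open>a\<close>; the fourth square is handled by induction. Should \<open>a\<close> itself be a corner, its term is \<open>1 / 0 = 0\<close>.
\<close>

lemma sum_inverse_dist_ge:
  assumes "a \<in> square n v"
  shows "(\<Sum>j<length v. 4 ^ (length v - j) / (4 * s (n + j))) \<le> (\<Sum>w\<in>words (length v). 1 / cmod (corner n w - a))"
  using assms
proof (induction v arbitrary: n a)
  case (Cons d v)
  define m where "m = length v"
  define shift where "shift = of_real (s n - s (Suc n)) * digit d"
  define X where "X = words (Suc m) - Cons d ` words m"
  define f where "f w = 1 / cmod (corner n w - a)" for w
  have f0: "f w \<ge> 0" for w by (simp add: f_def)
  have sub: "Cons d ` words m \<subseteq> words (Suc m)" by auto
  have a': "a - shift \<in> square (Suc n) v" using Cons(2) by (auto simp: mem_square shift_def)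
  have "(\<Sum>j<m. 4 ^ (m - j) / (4 * s (Suc n + j))) \<le> (\<Sum>w\<in>words m. 1 / cmod (corner (Suc n) w - (a - shift)))"
    unfolding m_def by (rule Cons(1)[OF a'])
  also have "\<dots> = (\<Sum>w\<in>Cons d ` words m. f w)"
    by (subst sum.reindex) (auto simp: f_def shift_def algebra_simps)
  finally have 1: "(\<Sum>j<m. 4 ^ (m - j) / (4 * s (Suc n + j))) \<le> (\<Sum>w\<in>Cons d ` words m. f w)" .
  have a_in: "0 \<le> Re a" "Re a \<le> s n" "0 \<le> Im a" "Im a \<le> s n"
    using Cons(2) corner_bounds[of n "d # v"] by (auto simp: mem_square)
  have f_ge: "1 / (2 * s n) \<le> f w" if "corner n w \<noteq> a" for w
  proof -
    have "cmod (corner n w - a) \<le> \<bar>Re (corner n w - a)\<bar> + \<bar>Im (corner n w - a)\<bar>"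
      by (rule cmod_le)
    also have "\<dots> \<le> 2 * s n"
      using corner_bounds[of n w] s_pos[of "n + length w"] a_in by auto
    finally show ?thesis unfolding f_def using that s_pos[of n] by (intro divide_left_mono mult_pos_pos) auto
  qed
  define Y where "Y = {w \<in> X. corner n w \<noteq> a}"
  have finX: "finite X" unfolding X_def by (intro finite_Diff finite_words)
  have "card X = 4 ^ Suc m - 4 ^ m"
    unfolding X_def using sub finite_words[of m]
    by (subst card_Diff_subset) (auto simp: card_words card_image)
  then have cX: "card X = 3 * 4 ^ m" by simp
  \<comment> \<open>At most one corner can coincide with \<open>a\<close>.\<close>
  have "card (X - Y) \<le> 1"
  proof (rule card_le_Suc0_iff_eq[THEN iffD2, folded One_nat_def])
    show "\<forall>x\<in>X - Y. \<forall>y\<in>X - Y. x = y"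
      using inj_on_corner[of n "Suc m"] by (auto simp: X_def Y_def inj_on_def)
  qed (use finX in simp)
  moreover have "card X = card (X - Y) + card Y"
    using finX by (subst card_Diff_subset) (auto simp: Y_def card_mono)
  moreover have "(1::nat) \<le> 4 ^ m" by simp
  ultimately have cY: "2 * 4 ^ m \<le> card Y" using cX by linarith
  have "4 ^ Suc m / (4 * s n) = real (2 * 4 ^ m) * (1 / (2 * s n))" by simp
  also have "\<dots> \<le> real (card Y) * (1 / (2 * s n))"
    using of_nat_mono[OF cY, where 'a = real] s_pos[of n] by (intro mult_right_mono) auto
  also have "\<dots> \<le> (\<Sum>w\<in>Y. f w)"
    using sum_bounded_below[of Y "1 / (2 * s n)" f] f_ge by (auto simp: Y_def)
  also have "\<dots> \<le> (\<Sum>w\<in>X. f w)"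
    using finX f0 by (intro sum_mono2) (auto simp: Y_def)
  finally have 2: "4 ^ Suc m / (4 * s n) \<le> (\<Sum>w\<in>X. f w)" .
  have "(\<Sum>j<Suc m. 4 ^ (Suc m - j) / (4 * s (n + j)))
      = 4 ^ Suc m / (4 * s n) + (\<Sum>j<m. 4 ^ (m - j) / (4 * s (Suc n + j)))"
    by (subst sum.lessThan_Suc_shift) simp
  also have "\<dots> \<le> (\<Sum>w\<in>X. f w) + (\<Sum>w\<in>Cons d ` words m. f w)" using 1 2 by linarith
  also have "\<dots> = (\<Sum>w\<in>words (Suc m). f w)"
    unfolding X_def by (rule sum.subset_diff[OF sub finite_words, symmetric])
  finally show ?case by (simp add: m_def f_def)
qed simp

text \<open>
  The previous bound, started at the square of generation \<open>n\<close> that contains \<open>a\<close>, so that all corners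
  used are close to \<open>a\<close>.
\<close>

lemma corners_near:
  assumes a: "a \<in> cantor" and n: "n \<le> N"
  obtains F where "F \<subseteq> corner 0 ` words N" "F \<subseteq> ball a (3 * s n) - {a}"
    "(\<Sum>j=n..<N. 4 ^ (N - j) / (4 * s j)) \<le> (\<Sum>p\<in>F. 1 / cmod (p - a))"
proof -
  obtain v where v: "length v = N" "a \<in> square 0 v" using a unfolding cantor_def by auto
  define u where "u = take n v"
  define x where "x = drop n v"
  have u: "length u = n" and x: "length x = N - n" and ux: "v = u @ x"
    using v n by (auto simp: u_def x_def)
  have c: "corner 0 (u @ w) = corner 0 u + corner n w" for w using u by (simp add: corner_append)
  have ax: "a - corner 0 u \<in> square n x" using v u x n by (auto simp: mem_square ux c)
  have a_in: "0 \<le> Re (a - corner 0 u)" "Re (a - corner 0 u) \<le> s n" "0 \<le> Im (a - corner 0 u)" "Im (a - corner 0 u) \<le> s n"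
    using ax corner_bounds[of n x] by (auto simp: mem_square)
  define G where "G = (\<lambda>w. corner 0 (u @ w)) ` words (N - n)"
  show ?thesis
  proof (rule that[of "G - {a}"])
    show "G - {a} \<subseteq> corner 0 ` words N" using u n by (auto simp: G_def)
    show "G - {a} \<subseteq> ball a (3 * s n) - {a}"
    proof -
      have "dist a (corner 0 (u @ w)) < 3 * s n" for w
      proof -
        have "dist a (corner 0 (u @ w)) = cmod ((a - corner 0 u) - corner n w)"
          by (simp add: dist_norm c algebra_simps)
        also have "\<dots> \<le> \<bar>Re ((a - corner 0 u) - corner n w)\<bar> + \<bar>Im ((a - corner 0 u) - corner n w)\<bar>"
          by (rule cmod_le)
        also have "\<dots> \<le> 2 * s n"
          using corner_bounds[of n w] s_pos[of "n + length w"] a_in by auto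
        finally show ?thesis using s_pos[of n] by simp
      qed
      then show ?thesis by (auto simp: G_def)
    qed
    have "(\<Sum>j=n..<N. 4 ^ (N - j) / (4 * s j)) = (\<Sum>j<N - n. 4 ^ (N - n - j) / (4 * s (n + j)))"
      using n by (simp add: sum.atLeastLessThan_shift_0[of _ n] lessThan_atLeast0)
    also have "\<dots> \<le> (\<Sum>w\<in>words (N - n). 1 / cmod (corner n w - (a - corner 0 u)))"
      using sum_inverse_dist_ge[OF ax] by (simp add: x)
    also have "\<dots> = (\<Sum>p\<in>G. 1 / cmod (p - a))"
      unfolding G_def
    proof (subst sum.reindex)
      show "inj_on (\<lambda>w. corner 0 (u @ w)) (words (N - n))"
        using inj_on_corner[of n "N - n"] by (simp add: c inj_on_def)
    qed (simp add: c algebra_simps)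
    also have "\<dots> = (\<Sum>p\<in>G - {a}. 1 / cmod (p - a))"
      by (rule sum.mono_neutral_right) (auto simp: G_def finite_words)
    finally show "(\<Sum>j=n..<N. 4 ^ (N - j) / (4 * s j)) \<le> (\<Sum>p\<in>G - {a}. 1 / cmod (p - a))" .
  qed
qed

text \<open>
  A ball of radius \<open>2 * s n\<close> meets boundedly many squares of generation \<open>n\<close>: their corners are
  separated by \<open>s n\<close> in one of the coordinates, so rounding the coordinates to a grid of mesh \<open>s n\<close>
  distinguishes them.
\<close>

lemma card_corners_in_ball_le:
  assumes n: "n \<le> N"
  shows "card {v \<in> words N. corner 0 v \<in> ball x (2 * s n)} \<le> 36 * 4 ^ (N - n)"
proof -
  define V where "V = {v \<in> words N. corner 0 v \<in> ball x (2 * s n)}"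
  define A where "A = take n ` V"
  define g where "g u = (\<lfloor>(Re (corner 0 u) - Re x) / s n\<rfloor>, \<lfloor>(Im (corner 0 u) - Im x) / s n\<rfloor>)" for u
  have finV: "finite V" unfolding V_def using finite_words by simp
  have "inj_on g A"
  proof (rule inj_onI, rule ccontr)
    fix u w assume uw: "u \<in> A" "w \<in> A" "g u = g w" "u \<noteq> w"
    then have len: "length u = n" "length w = n" using n by (auto simp: A_def V_def)
    have floor_close: "\<bar>y - z\<bar> < s n" if "\<lfloor>(y - c) / s n\<rfloor> = \<lfloor>(z - c) / s n\<rfloor>" for y z c
    proof -
      have "\<bar>(y - c) / s n - (z - c) / s n\<bar> < 1" using that by linarith
      then have "\<bar>(y - z) / s n\<bar> < 1" by (simp flip: diff_divide_distrib)
      then show ?thesis using s_pos[of n] by (simp add: abs_divide)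
    qed
    show False
      using corner_separated[of u w 0] len uw floor_close by (auto simp: g_def)
        (metis linorder_not_less)+
  qed
  moreover have "g ` A \<subseteq> {-3..2} \<times> {-3..2}"
  proof
    fix y assume "y \<in> g ` A"
    then obtain v where v: "v \<in> V" "y = g (take n v)" by (auto simp: A_def)
    have c: "corner 0 v = corner 0 (take n v) + corner n (drop n v)"
      using corner_append[of 0 "take n v" "drop n v"] v n by (simp add: V_def)
    have "cmod (corner 0 v - x) < 2 * s n" using v by (simp add: V_def dist_norm norm_minus_commute)
    then have "\<bar>Re (corner 0 v - x)\<bar> < 2 * s n" "\<bar>Im (corner 0 v - x)\<bar> < 2 * s n"
      using abs_Re_le_cmod abs_Im_le_cmod by (meson le_less_trans)+
    then have "- 3 * s n \<le> Re (corner 0 (take n v)) - Re x" "Re (corner 0 (take n v)) - Re x < 3 * s n"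
      "- 3 * s n \<le> Im (corner 0 (take n v)) - Im x" "Im (corner 0 (take n v)) - Im x < 3 * s n"
      using corner_bounds[of n "drop n v"] s_pos[of "n + length (drop n v)"] s_pos[of n]
      by (auto simp: c)
    then show "y \<in> {-3..2} \<times> {-3..2}"
      using s_pos[of n] by (auto simp: v g_def le_floor_iff floor_le_iff field_simps)
  qed
  ultimately have "card A \<le> card ({-3..2::int} \<times> {-3..2::int})"
    by (intro card_inj_on_le) auto
  then have cA: "card A \<le> 36" by simp
  have "V \<subseteq> (\<lambda>(u, w). u @ w) ` (A \<times> words (N - n))"
  proof
    fix v assume "v \<in> V"
    then have "(take n v, drop n v) \<in> A \<times> words (N - n)" by (auto simp: A_def V_def)
    moreover have "v = (\<lambda>(u, w). u @ w) (take n v, drop n v)" by simp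
    ultimately show "v \<in> (\<lambda>(u, w). u @ w) ` (A \<times> words (N - n))" by (rule rev_image_eqI)
  qed
  then have "card V \<le> card ((\<lambda>(u, w). u @ w) ` (A \<times> words (N - n)))"
    using finV finite_words by (intro card_mono) (auto simp: A_def)
  also have "\<dots> \<le> card (A \<times> words (N - n))"
    using finV finite_words by (intro card_image_le) (auto simp: A_def)
  also have "\<dots> \<le> 36 * 4 ^ (N - n)"
    using cA by (simp add: card_cartesian_product card_words)
  finally show ?thesis by (simp add: V_def)
qed

end

section \<open>Hausdorff measure of a corner Cantor set\<close>

context cantor_scales
begin

text \<open>
  Each covering set of diameter \<open>d\<close> with \<open>0 < d < s 0\<close> is put into a ball of radius \<open>2 * s n\<close>, where \<open>n\<close> is the
  last generation with \<open>d < s n\<close>; such a ball holds a proportion of at most \<open>36 / 4 ^ n\<close> of all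
  corners of a late generation, and \<open>h / 4 ^ n\<close> is at most \<open>4 * \<Psi> d\<close>. By compactness finitely many
  of the balls suffice, so that counting corners of one single generation gives the bound. For sets
  of diameter \<open>0\<close> there is no last such \<open>n\<close>; the summable errors \<open>e i\<close> pay for them.
\<close>

lemma hausdorff_measure_cantor_pos:
  assumes \<Psi>0: "\<Psi> 0 = 0" and mono: "strict_mono_on {0..} \<Psi>"
    and h: "h > 0" and \<Psi>s: "\<And>n. \<Psi> (s n) = h / 4 ^ n"
  shows "hausdorff_measure \<Psi> cantor > 0"
proof -
  have \<Psi>_mono: "\<Psi> x \<le> \<Psi> y" if "0 \<le> x" "x \<le> y" for x y
    using mono that by (meson atLeast_iff order_trans strict_mono_on_leD)
  have "ennreal (h / 288) \<le> hausdorff_content \<Psi> 1 cantor"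
    unfolding hausdorff_content_def
  proof (rule INF_greatest)
    fix C :: "nat \<Rightarrow> complex set"
    assume "C \<in> {C. cantor \<subseteq> (\<Union>i. C i) \<and> (\<forall>i. bounded (C i) \<and> diameter (C i) \<le> 1)}"
    then have cover: "cantor \<subseteq> (\<Union>i. C i)" and bd: "\<And>i. bounded (C i)" by auto
    define d where "d i = diameter (C i)" for i
    have d0: "d i \<ge> 0" for i using bd[of i] by (simp add: d_def diameter_ge_0)
    have \<Psi>d0: "\<Psi> (d i) \<ge> 0" for i using \<Psi>_mono[of 0 "d i"] d0[of i] \<Psi>0 by simp
    have "ennreal (h / 288) \<le> (\<Sum>i. ennreal (\<Psi> (d i)))"
    proof (cases "\<exists>i. s 0 \<le> d i")
      case True
      then obtain i where "s 0 \<le> d i" ..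
      then have "h \<le> \<Psi> (d i)" using \<Psi>_mono[of "s 0" "d i"] s_pos[of 0] \<Psi>s[of 0] by simp
      then have "ennreal (h / 288) \<le> ennreal (\<Psi> (d i))" using h by (intro ennreal_leI) simp
      also have "\<dots> \<le> (\<Sum>i. ennreal (\<Psi> (d i)))"
        using sum_le_suminf[of "\<lambda>i. ennreal (\<Psi> (d i))" "{i}"] by simp
      finally show ?thesis .
    next
      case False
      define e where "e i = h / 144 * (1/2) ^ Suc i" for i :: nat
      have e: "e i > 0" for i using h by (simp add: e_def)
      have "\<exists>n. d i < s n \<and> h / 4 ^ n \<le> 4 * \<Psi> (d i) + e i" for i
      proof (cases "d i = 0")
        case True
        obtain n where "h / e i < 4 ^ n" using real_arch_pow[of 4 "h / e i"] by auto
        then have "h / 4 ^ n \<le> e i" using e[of i] by (simp add: field_simps)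
        then show ?thesis using True s_pos[of n] \<Psi>0 by auto
      next
        case False
        define m where "m = (LEAST m. s m \<le> d i)"
        have "\<forall>\<^sub>F m in sequentially. s m < d i"
          using False d0[of i] by (intro order_tendstoD(2)[OF s_tendsto_0]) auto
        then obtain m0 where "s m0 \<le> d i"
          using eventually_happens'[OF sequentially_bot] less_imp_le by blast
        then have m: "s m \<le> d i" unfolding m_def by (rule LeastI)
        have "m \<noteq> 0" using m \<open>\<not> (\<exists>i. s 0 \<le> d i)\<close> by metis
        then obtain n where n: "m = Suc n" by (cases m) auto
        have "d i < s n" using not_less_Least[of n "\<lambda>m. s m \<le> d i"] n by (simp add: m_def)
        moreover have "h / 4 ^ n = 4 * \<Psi> (s m)" by (simp add: \<Psi>s n)
        moreover have "\<Psi> (s m) \<le> \<Psi> (d i)" using m s_pos[of m] by (intro \<Psi>_mono) auto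
        ultimately show ?thesis using e[of i] by (intro exI[of _ n]) auto
      qed
      then have "\<forall>i. \<exists>n. d i < s n \<and> h / 4 ^ n \<le> 4 * \<Psi> (d i) + e i" ..
      then obtain n where "\<forall>i. d i < s (n i) \<and> h / 4 ^ n i \<le> 4 * \<Psi> (d i) + e i"
        by (rule choice[THEN exE])
      then have n: "d i < s (n i)" "h / 4 ^ n i \<le> 4 * \<Psi> (d i) + e i" for i by simp_all
      define x where "x i = (SOME y. y \<in> C i)" for i
      define U where "U i = ball (x i) (2 * s (n i))" for i
      have "C i \<subseteq> U i" for i
      proof
        fix y assume y: "y \<in> C i"
        then have "x i \<in> C i" unfolding x_def by (rule someI)
        then have "dist (x i) y \<le> d i" unfolding d_def using bd y by (intro diameter_bounded_bound)
        then show "y \<in> U i" using n(1)[of i] s_pos[of "n i"] by (simp add: U_def)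
      qed
      then have "(\<Union>i. C i) \<subseteq> (\<Union>i. U i)" by (intro UN_mono order_refl)
      with cover have "cantor \<subseteq> (\<Union>i\<in>UNIV. U i)" by (rule order_trans)
      moreover have "open (U i)" for i by (simp add: U_def)
      ultimately obtain I where I: "finite I" "cantor \<subseteq> (\<Union>i\<in>I. U i)"
        using compactE_image[OF compact_cantor] by metis
      define N where "N = (\<Sum>i\<in>I. n i)"
      have nN: "n i \<le> N" if "i \<in> I" for i unfolding N_def using I(1) that by (intro member_le_sum) auto
      have "words N \<subseteq> (\<Union>i\<in>I. {v \<in> words N. corner 0 v \<in> U i})"
        using corner_in_cantor I(2) by blast
      then have "card (words N) \<le> card (\<Union>i\<in>I. {v \<in> words N. corner 0 v \<in> U i})"
        using I(1) finite_words by (intro card_mono) auto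
      also have "\<dots> \<le> (\<Sum>i\<in>I. card {v \<in> words N. corner 0 v \<in> U i})"
        using I(1) by (rule card_UN_le)
      also have "\<dots> \<le> (\<Sum>i\<in>I. 36 * 4 ^ (N - n i))"
        unfolding U_def by (intro sum_mono card_corners_in_ball_le nN)
      finally have "real (4 ^ N) \<le> real (\<Sum>i\<in>I. 36 * 4 ^ (N - n i))"
        unfolding card_words by (rule of_nat_mono)
      also have "\<dots> = (\<Sum>i\<in>I. 36 * (4 ^ N / 4 ^ n i))"
        unfolding of_nat_sum of_nat_mult of_nat_power of_nat_numeral
        using nN by (intro sum.cong refl arg_cong[where f = "(*) 36"] power_diff) auto
      finally have "1 * 4 ^ N \<le> (\<Sum>i\<in>I. 36 / 4 ^ n i) * (4::real) ^ N"
        by (simp add: sum_distrib_right)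
      then have "1 \<le> (\<Sum>i\<in>I. 36 / (4::real) ^ n i)" by (subst (asm) mult_le_cancel_right) auto
      then have "h * 1 \<le> h * (\<Sum>i\<in>I. 36 / (4::real) ^ n i)" using h by (intro mult_left_mono) auto
      also have "\<dots> = (\<Sum>i\<in>I. 36 * (h / 4 ^ n i))" by (simp add: sum_distrib_left mult.commute)
      also have "\<dots> \<le> (\<Sum>i\<in>I. 36 * (4 * \<Psi> (d i) + e i))"
        by (intro sum_mono mult_left_mono n(2)) simp
      also have "\<dots> = 144 * (\<Sum>i\<in>I. \<Psi> (d i)) + 36 * (\<Sum>i\<in>I. e i)"
        by (simp add: sum.distrib distrib_left flip: sum_distrib_left mult.assoc)
      also have "(\<Sum>i\<in>I. e i) \<le> h / 144"
      proof -
        have "(\<Sum>i\<in>I. (1/2) ^ Suc i) \<le> (1::real)"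
          using sum_le_suminf[OF sums_summable[OF power_half_series] I(1)] sums_unique[OF power_half_series] by simp
        then have "h / 144 * (\<Sum>i\<in>I. (1/2) ^ Suc i) \<le> h / 144 * 1" using h by (intro mult_left_mono) auto
        then show ?thesis by (simp only: e_def sum_distrib_left)
      qed
      finally have "h / 288 \<le> (\<Sum>i\<in>I. \<Psi> (d i))" using h by simp
      then have "ennreal (h / 288) \<le> ennreal (\<Sum>i\<in>I. \<Psi> (d i))" by (rule ennreal_leI)
      also have "\<dots> = (\<Sum>i\<in>I. ennreal (\<Psi> (d i)))" using \<Psi>d0 by simp
      also have "\<dots> \<le> (\<Sum>i. ennreal (\<Psi> (d i)))" using I(1) by (intro sum_le_suminf) auto
      finally show ?thesis .
    qed
    then show "ennreal (h / 288) \<le> (\<Sum>i. ennreal (\<Psi> (diameter (C i))))" by (simp add: d_def)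
  qed
  also have "\<dots> \<le> hausdorff_measure \<Psi> cantor"
    unfolding hausdorff_measure_def by (rule SUP_upper) simp
  finally have "ennreal (h / 288) \<le> hausdorff_measure \<Psi> cantor" .
  moreover have "0 < ennreal (h / 288)" using h by simp
  ultimately show ?thesis by (rule less_le_trans[rotated])
qed

text \<open>
  Here \<open>M\<close> is a lower bound for \<open>\<Psi> / \<psi>\<close> at \<open>s n\<close>. If \<open>\<Psi>\<close> is so large near \<open>0\<close> that \<open>s n\<close> decays
  faster than \<open>exp (- 4 n)\<close>, the bound through \<open>M\<close> is useless, but then \<open>4 ^ n * s n \<le> 1\<close>.
\<close>

lemma inverse_scale_ge:
  assumes \<Psi>s: "\<Psi> (s n) = h / 4 ^ n" and h: "h > 0" and n: "n \<ge> 1" and M: "M > 0"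
    and s: "s n \<le> exp (-1)" and big: "M * psi (s n) \<le> \<Psi> (s n)"
  shows "min 1 (M / (16 * h * (real n)\<^sup>2)) \<le> 1 / (4 ^ n * s n)"
proof -
  define l where "l = ln (1 / s n)"
  have ls: "s n = exp (- l)" using s_pos[of n] by (simp add: l_def ln_div)
  have l1: "l \<ge> 1" using s by (simp add: ls)
  show ?thesis
  proof (cases "l \<le> 4 * real n")
    case True
    have "l\<^sup>2 \<le> (4 * real n)\<^sup>2" using True l1 by (intro power_mono) auto
    then have l2: "l\<^sup>2 \<le> 16 * (real n)\<^sup>2" by (simp add: power_mult_distrib)
    have "M * (s n / l\<^sup>2) \<le> h / 4 ^ n"
      using big s by (simp add: psi_def l_def \<Psi>s)
    then have "M \<le> h * l\<^sup>2 / (4 ^ n * s n)"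
      using l1 s_pos[of n] by (simp add: field_simps)
    also have "\<dots> \<le> h * (16 * (real n)\<^sup>2) / (4 ^ n * s n)"
      using l2 h s_pos[of n] by (intro divide_right_mono mult_left_mono) auto
    finally have "M / (16 * h * (real n)\<^sup>2) \<le> 1 / (4 ^ n * s n)"
      using h n s_pos[of n] by (simp add: field_simps)
    then show ?thesis by simp
  next
    case False
    have "(4::real) ^ n \<le> exp 4 ^ n" using exp_ge_add_one_self[of 4] by (intro power_mono) auto
    also have "\<dots> = exp (4 * real n)" by (simp add: exp_of_nat_mult mult.commute)
    also have "\<dots> \<le> exp l" using False by simp
    finally have "4 ^ n * s n \<le> 1" by (simp add: ls exp_minus field_simps)
    then have "1 \<le> 1 / (4 ^ n * s n)" using s_pos[of n] by (simp add: field_simps)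
    then show ?thesis by linarith
  qed
qed

end

lemma hausdorff_measure_empty:
  assumes "\<Psi> 0 = 0"
  shows "hausdorff_measure \<Psi> {} = 0"
proof -
  have "hausdorff_content \<Psi> \<delta> {} \<le> 0" if "\<delta> > 0" for \<delta>
    unfolding hausdorff_content_def
    by (rule INF_lower2[of "\<lambda>_. {}"]) (use assms that in auto)
  then show ?thesis unfolding hausdorff_measure_def by (simp add: SUP_eq_const)
qed

section \<open>The measure on the corners\<close>

text \<open>
  The intermediate value theorem provides the side lengths. If \<open>s (Suc n)\<close> were larger than
  \<open>s n / 2\<close>, then \<open>\<Psi> (s n / 2) < \<Psi> (s n) / 4\<close>, which contradicts \<open>\<Psi> (2 * r) < 4 * \<Psi> r\<close>.
\<close>

lemma exists_cantor_scales:
  fixes \<Psi> :: "real \<Rightarrow> real"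
  assumes \<Psi>0: "\<Psi> 0 = 0" and cont: "continuous_on {0..} \<Psi>" and mono: "strict_mono_on {0..} \<Psi>"
    and doubling: "Limsup (at_right 0) (\<lambda>r. ereal (\<Psi> (2 * r) / \<Psi> r)) < 4" and "\<epsilon> > 0"
  obtains s h where "cantor_scales s" "h > 0" "\<And>n. \<Psi> (s n) = h / 4 ^ n" "s 0 \<le> \<epsilon>"
proof -
  have pos: "\<Psi> x > 0" if "x > 0" for x
    using strict_mono_onD[OF mono, of 0 x] that \<Psi>0 by simp
  have "\<forall>\<^sub>F r in at_right 0. ereal (\<Psi> (2 * r) / \<Psi> r) < 4"
    using doubling by (rule Limsup_lessD)
  then obtain b where b: "b > 0" "\<And>r. 0 < r \<Longrightarrow> r < b \<Longrightarrow> ereal (\<Psi> (2 * r) / \<Psi> r) < 4"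
    unfolding eventually_at_right_field by auto
  have dbl: "\<Psi> (2 * r) < 4 * \<Psi> r" if "0 < r" "r < b" for r
    using b(2)[OF that] pos[OF that(1)] by (simp add: field_simps)
  define r0 where "r0 = min \<epsilon> (b / 2)"
  define h where "h = \<Psi> r0"
  have r0: "0 < r0" "r0 \<le> \<epsilon>" "r0 < b" using \<open>\<epsilon> > 0\<close> b(1) by (auto simp: r0_def)
  have h: "h > 0" using pos r0 by (simp add: h_def)
  have "\<exists>x. 0 \<le> x \<and> x \<le> r0 \<and> \<Psi> x = h / 4 ^ n" for n
  proof (rule IVT')
    have "h / 4 ^ n \<le> h / 1" using h by (intro divide_left_mono) auto
    then show "h / 4 ^ n \<le> \<Psi> r0" by (simp add: h_def)
    show "continuous_on {0..r0} \<Psi>" by (rule continuous_on_subset[OF cont]) auto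
  qed (use r0 h \<Psi>0 in auto)
  then obtain s where s: "\<And>n. 0 \<le> s n" "\<And>n. s n \<le> r0" "\<And>n. \<Psi> (s n) = h / 4 ^ n" by metis
  have spos: "s n > 0" for n
    using s(1,3)[of n] \<Psi>0 h by (cases "s n = 0") auto
  have "2 * s (Suc n) \<le> s n" for n
  proof (rule ccontr)
    assume "\<not> 2 * s (Suc n) \<le> s n"
    then have "\<Psi> (s n / 2) < \<Psi> (s (Suc n))"
      using spos[of n] by (intro strict_mono_onD[OF mono]) auto
    moreover have "\<Psi> (s n) < 4 * \<Psi> (s n / 2)"
      using dbl[of "s n / 2"] spos[of n] s(2)[of n] r0 by simp
    ultimately show False by (simp add: s(3))
  qed
  then have "cantor_scales s" using spos by unfold_locales auto
  then show ?thesis using that h s r0 by (meson order_trans)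
qed

text \<open>
  The sum over \<open>k\<close> of the uniform distributions on the sets \<open>A k\<close>, with weights \<open>2\<^sup>-\<^sup>k\<close>.
\<close>

lemma exists_atomic_measure:
  fixes A :: "nat \<Rightarrow> complex set"
  assumes A: "\<And>k. finite (A k)" "\<And>k. A k \<noteq> {}" "\<And>k. A k \<subseteq> cball 0 R"
  obtains M where "finite_measure M" "sets M = sets borel" "AE w in M. cmod w \<le> R"
    "\<And>k p. p \<in> A k \<Longrightarrow> (1/2) ^ k / card (A k) \<le> measure M {p}"
proof -
  define c where "c k = (1/2) ^ k / card (A k)" for k
  have card: "card (A k) > 0" for k using A[of k] by (simp add: card_gt_0_iff)
  define f :: "complex \<Rightarrow> ennreal" where "f p = (\<Sum>k. ennreal (c k) * indicator (A k) p)" for p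
  define M where "M = distr (density (count_space UNIV) f) borel (\<lambda>p. p)"
  have em: "emeasure M B = (\<integral>\<^sup>+p. f p * indicator B p \<partial>count_space UNIV)" if "B \<in> sets borel" for B
    using that by (simp add: M_def emeasure_distr emeasure_density)
  have "emeasure M UNIV = (\<Sum>k. \<integral>\<^sup>+p. ennreal (c k) * indicator (A k) p \<partial>count_space UNIV)"
    by (simp add: em f_def nn_integral_suminf)
  also have "\<dots> = (\<Sum>k. ennreal ((1/2) ^ k))"
  proof (rule suminf_cong)
    fix k
    have "(\<integral>\<^sup>+p. ennreal (c k) * indicator (A k) p \<partial>count_space UNIV) = ennreal (c k) * card (A k)"
      using A(1)[of k] by (subst nn_integral_cmult_indicator) (auto simp: ennreal_of_nat_eq_real_of_nat)
    also have "\<dots> = ennreal ((1/2) ^ k)"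
      using card[of k] by (simp add: c_def ennreal_of_nat_eq_real_of_nat flip: ennreal_mult'')
    finally show "(\<integral>\<^sup>+p. ennreal (c k) * indicator (A k) p \<partial>count_space UNIV) = ennreal ((1/2) ^ k)" .
  qed
  also have "\<dots> \<noteq> top" by (rule ennreal_suminf_neq_top) (auto simp: summable_geometric)
  finally have fin: "finite_measure M" by (intro finite_measureI) (simp add: M_def)
  moreover have "AE w in M. cmod w \<le> R"
    unfolding M_def
  proof (subst AE_distr_iff)
    have "cmod w \<le> R" if "0 < f w" for w
    proof (rule ccontr)
      assume "\<not> cmod w \<le> R"
      then have "w \<notin> A k" for k using A(3)[of k] by auto
      then show False using that by (simp add: f_def)
    qed
    then show "AE w in density (count_space UNIV) f. cmod w \<le> R"
      by (subst AE_density) auto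
  qed auto
  moreover have "(1/2) ^ k / card (A k) \<le> measure M {p}" if "p \<in> A k" for k p
  proof -
    have "ennreal (c k) \<le> f p"
      using that sum_le_suminf[of "\<lambda>k. ennreal (c k) * indicator (A k) p" "{k}"] by (simp add: f_def)
    also have "f p = emeasure M {p}"
      using nn_integral_count_space_indicator[of "{p}" f] by (simp add: em nn_integral_count_space_finite)
    finally show ?thesis
      using fin by (simp add: finite_measure.emeasure_eq_measure c_def)
  qed
  ultimately show ?thesis using that[of M] by (simp add: M_def)
qed

text \<open>
  The generations \<open>n \<le> j < 2 * n\<close> each contribute at least a quarter of \<open>2\<^sup>-\<^sup>k c\<close>, where \<open>c\<close> is the
  minimum of \<open>1\<close> and \<open>2\<^sup>k / (64 h n\<^sup>2)\<close>, and \<open>log (1 / (3 s n)) \<ge> n log 2\<close>. So the product is at least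
  \<open>n\<^sup>2 2\<^sup>-\<^sup>k c\<close> up to a constant, which the choice \<open>n \<ge> 2\<^sup>k\<close> keeps away from \<open>0\<close> whichever term
  attains the minimum.
\<close>

lemma (in cantor_scales) log_energy_ge:
  assumes \<Psi>s: "\<And>n. \<Psi> (s n) = h / 4 ^ n" and h: "h > 0" and s0: "s 0 \<le> 1 / 3"
    and n: "2 ^ k \<le> n"
    and small: "\<And>j. n \<le> j \<Longrightarrow> s j \<le> exp (-1)"
    and big: "\<And>j. n \<le> j \<Longrightarrow> 2 ^ k * psi (s j) \<le> \<Psi> (s j)"
  shows "ln 2 / 4 * min 1 (1 / (64 * h)) \<le>
    ln (1 / (3 * s n)) * (\<Sum>j=n..<2 * n. (1/2) ^ k / 4 ^ (2 * n) * (4 ^ (2 * n - j) / (4 * s j)))"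
proof -
  have n1: "n \<ge> 1" using n by (meson le_trans one_le_numeral one_le_power)
  have kn: "2 ^ k \<le> real n" using of_nat_mono[OF n, where 'a = real] by simp
  define c where "c = min 1 (2 ^ k / (64 * h * (real n)\<^sup>2))"
  have c0: "c \<ge> 0" using h by (simp add: c_def)
  have each: "(1/2) ^ k * (c / 4) \<le> (1/2) ^ k / 4 ^ (2 * n) * (4 ^ (2 * n - j) / (4 * s j))"
    if j: "j \<in> {n..<2 * n}" for j
  proof -
    have "c \<le> min 1 (2 ^ k / (16 * h * (real j)\<^sup>2))"
    proof -
      have "(real j)\<^sup>2 \<le> (2 * real n)\<^sup>2" using j by (intro power_mono) auto
      then have "16 * h * (real j)\<^sup>2 \<le> 64 * h * (real n)\<^sup>2" using h by (simp add: power_mult_distrib)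
      then have "2 ^ k / (64 * h * (real n)\<^sup>2) \<le> 2 ^ k / (16 * h * (real j)\<^sup>2)"
        using j n1 h by (intro divide_left_mono mult_pos_pos) auto
      then show ?thesis by (auto simp: c_def)
    qed
    also have "\<dots> \<le> 1 / (4 ^ j * s j)"
      using j n1 by (intro inverse_scale_ge[of \<Psi> j h "2 ^ k"] \<Psi>s h small big) auto
    finally have "(1/2) ^ k * (c / 4) \<le> (1/2) ^ k * (1 / (4 ^ j * s j) / 4)"
      by (intro mult_left_mono divide_right_mono) auto
    also have "\<dots> = (1/2) ^ k / 4 ^ (2 * n) * (4 ^ (2 * n - j) / (4 * s j))"
      using j by (simp add: power_diff)
    finally show ?thesis .
  qed
  have L: "real n * ln 2 \<le> ln (1 / (3 * s n))"
  proof -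
    have "3 * s n \<le> 1 / 2 ^ n" using s_le_power[of n] s0 by (simp add: field_simps)
    then have "2 ^ n \<le> 1 / (3 * s n)" using s_pos[of n] by (simp add: field_simps)
    then have "ln (2 ^ n) \<le> ln (1 / (3 * s n))" using s_pos[of n] by (subst ln_le_cancel_iff) auto
    then show ?thesis by (simp add: ln_realpow)
  qed
  have "min 1 (1 / (64 * h)) \<le> real n * real n * (1/2) ^ k * c"
  proof (cases "c = 1")
    case True
    have "1 * 1 \<le> (real n * (1/2) ^ k) * real n"
      using kn n1 by (intro mult_mono) (auto simp: field_simps)
    then have "1 \<le> real n * real n * (1/2) ^ k * c" using True by (simp add: mult_ac)
    then show ?thesis by linarith
  next
    case False
    then have "c = 2 ^ k / (64 * h * (real n)\<^sup>2)" by (auto simp: c_def min_def split: if_splits)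
    then have "real n * real n * (1/2) ^ k * c = 1 / (64 * h)"
      using n1 h by (simp add: field_simps power2_eq_square)
    then show ?thesis by simp
  qed
  then have "ln 2 / 4 * min 1 (1 / (64 * h)) \<le> ln 2 / 4 * (real n * real n * (1/2) ^ k * c)"
    by (intro mult_left_mono) auto
  also have "\<dots> = (real n * ln 2) * (real n * ((1/2) ^ k * (c / 4)))" by simp
  also have "\<dots> \<le> ln (1 / (3 * s n)) * (real n * ((1/2) ^ k * (c / 4)))"
    using L c0 by (intro mult_right_mono) auto
  also have "\<dots> \<le> ln (1 / (3 * s n)) *
      (\<Sum>j=n..<2 * n. (1/2) ^ k / 4 ^ (2 * n) * (4 ^ (2 * n - j) / (4 * s j)))"
  proof (rule mult_left_mono)
    show "real n * ((1/2) ^ k * (c / 4)) \<le>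
        (\<Sum>j=n..<2 * n. (1/2) ^ k / 4 ^ (2 * n) * (4 ^ (2 * n - j) / (4 * s j)))"
      using sum_bounded_below[of "{n..<2 * n}" "(1/2) ^ k * (c / 4)"] each by simp
    show "0 \<le> ln (1 / (3 * s n))" by (rule order_trans[OF _ L]) simp
  qed
  finally show ?thesis .
qed

theorem theorem7:
  fixes \<Psi> :: "real \<Rightarrow> real"
  assumes "\<Psi> 0 = 0"
    and "\<forall>r\<ge>0. \<Psi> r \<ge> 0"
    and "continuous_on {0..} \<Psi>"
    and "strict_mono_on {0..} \<Psi>"
    and "Limsup (at_right 0) (\<lambda>r. ereal (\<Psi> (2 * r) / \<Psi> r)) < 4"
    and "filterlim (\<lambda>r. \<Psi> r / psi r) at_top (at_right 0)"
  shows "\<exists>(K :: complex set) (\<nu> :: complex set \<Rightarrow> real).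
           compact K \<and> hausdorff_measure \<Psi> K > 0 \<and>
           signed_borel_measure \<nu> \<and>
           integrable (total_variation \<nu>) (\<lambda>w. ln (1 + cmod w)) \<and>
           hausdorff_measure \<Psi>
             {a \<in> K. capacity_differentiable (log_potential_domain \<nu>) (log_potential \<nu>) a} = 0"
proof -
  obtain s h where cs: "cantor_scales s" and h: "h > 0" and \<Psi>s: "\<And>n. \<Psi> (s n) = h / 4 ^ n"
    and s0: "s 0 \<le> min (1 / 3) (exp (-1))"
    by (rule exists_cantor_scales[OF assms(1,3-5), of "min (1 / 3) (exp (-1))"]) auto
  interpret cantor_scales s by (rule cs)
  have s_small: "s j \<le> exp (-1)" for j using s_antimono[of 0 j] s0 by simp
  have "\<exists>n. 2 ^ k \<le> n \<and> (\<forall>j\<ge>n. 2 ^ k * psi (s j) \<le> \<Psi> (s j))" for k :: nat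
  proof -
    have "\<forall>\<^sub>F r in at_right 0. 2 ^ k \<le> \<Psi> r / psi r"
      using assms(6) by (simp add: filterlim_at_top)
    moreover have "filterlim s (at_right 0) sequentially"
      using s_tendsto_0 s_pos by (intro tendsto_imp_filterlim_at_right) auto
    ultimately have "\<forall>\<^sub>F j in sequentially. 2 ^ k \<le> \<Psi> (s j) / psi (s j)"
      by (rule eventually_compose_filterlim)
    then obtain m where m: "\<And>j. m \<le> j \<Longrightarrow> 2 ^ k \<le> \<Psi> (s j) / psi (s j)"
      by (auto simp: eventually_sequentially)
    have psi: "psi (s j) > 0" for j
    proof -
      have "ln (s j) < 0" using s_small[of j] s_pos[of j] by (simp add: le_less_trans)
      then show ?thesis using s_small[of j] s_pos[of j] by (auto simp: psi_def ln_div)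
    qed
    show ?thesis
      using m psi by (intro exI[of _ "max m (2 ^ k)"]) (auto simp: field_simps)
  qed
  then obtain n :: "nat \<Rightarrow> nat" where n: "\<And>k. 2 ^ k \<le> n k"
    and big: "\<And>k j. n k \<le> j \<Longrightarrow> 2 ^ k * psi (s j) \<le> \<Psi> (s j)" by metis
  define R where "R = 2 * s 0"
  define A where "A k = corner 0 ` words (2 * n k)" for k
  have finA: "finite (A k)" for k unfolding A_def by (intro finite_imageI finite_words)
  have cardA: "card (A k) = 4 ^ (2 * n k)" for k
    unfolding A_def by (simp add: card_image inj_on_corner card_words)
  have "A k \<noteq> {}" for k using cardA[of k] by auto
  moreover have "A k \<subseteq> cball 0 R" for k
  proof
    fix p assume "p \<in> A k"
    then obtain v where p: "p = corner 0 v" by (auto simp: A_def)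
    have "cmod p \<le> \<bar>Re p\<bar> + \<bar>Im p\<bar>" by (rule cmod_le)
    also have "\<dots> \<le> R" using corner_bounds[of 0 v] s_pos[of "length v"] by (auto simp: p R_def)
    finally show "p \<in> cball 0 R" by simp
  qed
  ultimately obtain N where N: "finite_measure N" "sets N = sets (borel :: complex measure)"
      "AE w in N. cmod w \<le> R"
    and atoms: "\<And>k p. p \<in> A k \<Longrightarrow> (1/2) ^ k / card (A k) \<le> measure N {p}"
    using exists_atomic_measure[of A R] finA by metis
  have R: "R > 0" using s_pos[of 0] by (simp add: R_def)
  interpret compactly_supported_measure N R
    using N R by (simp add: compactly_supported_measure_def compactly_supported_measure_axioms_def)
  have nondiff: "\<not> capacity_differentiable dom (log_potential (measure N)) a" if a: "a \<in> cantor" for a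
  proof -
    have "\<forall>k. \<exists>F. F \<subseteq> A k \<and> F \<subseteq> ball a (3 * s (n k)) - {a} \<and>
        (\<Sum>j=n k..<2 * n k. 4 ^ (2 * n k - j) / (4 * s j)) \<le> (\<Sum>p\<in>F. 1 / cmod (p - a))"
    proof
      fix k
      have "n k \<le> 2 * n k" by simp
      from a this obtain F where "F \<subseteq> A k" "F \<subseteq> ball a (3 * s (n k)) - {a}"
        "(\<Sum>j=n k..<2 * n k. 4 ^ (2 * n k - j) / (4 * s j)) \<le> (\<Sum>p\<in>F. 1 / cmod (p - a))"
        unfolding A_def by (rule corners_near)
      then show "\<exists>F. F \<subseteq> A k \<and> F \<subseteq> ball a (3 * s (n k)) - {a} \<and>
        (\<Sum>j=n k..<2 * n k. 4 ^ (2 * n k - j) / (4 * s j)) \<le> (\<Sum>p\<in>F. 1 / cmod (p - a))"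
        by blast
    qed
    then obtain F where "\<forall>k. F k \<subseteq> A k \<and> F k \<subseteq> ball a (3 * s (n k)) - {a} \<and>
        (\<Sum>j=n k..<2 * n k. 4 ^ (2 * n k - j) / (4 * s j)) \<le> (\<Sum>p\<in>F k. 1 / cmod (p - a))"
      by (rule choice[THEN exE])
    then have F: "F k \<subseteq> A k" "F k \<subseteq> ball a (3 * s (n k)) - {a}"
      and sumF: "(\<Sum>j=n k..<2 * n k. 4 ^ (2 * n k - j) / (4 * s j)) \<le> (\<Sum>p\<in>F k. 1 / cmod (p - a))" for k
      by simp_all
    show ?thesis
    proof (rule not_capacity_differentiable)
      show "0 < ln 2 / 4 * min 1 (1 / (64 * h))" using h by simp
      show "(\<lambda>k. 3 * s (n k)) \<longlonglongrightarrow> 0"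
      proof -
        have "k \<le> n k" for k using n[of k] less_exp[of k] by linarith
        then have "filterlim n at_top sequentially"
          by (intro filterlim_at_top_mono[OF filterlim_ident]) auto
        then have "(\<lambda>k. s (n k)) \<longlonglongrightarrow> 0" by (rule filterlim_compose[OF s_tendsto_0])
        then show ?thesis using tendsto_mult_right_zero by blast
      qed
      show "0 < 3 * s (n k)" for k using s_pos by simp
      show r1: "3 * s (n k) < 1" for k
      proof -
        have "1 \<le> n k" using n[of k] by (meson le_trans one_le_numeral one_le_power)
        then have "s (n k) \<le> s 1" by (rule s_antimono)
        then show ?thesis using s_half[of 0] s0 s_pos[of 0] by simp
      qed
      show "finite (F k)" for k using F(1) finA by (rule finite_subset)
      show "F k \<subseteq> ball a (3 * s (n k)) - {a}" for k by (rule F(2))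
      show "ln 2 / 4 * min 1 (1 / (64 * h)) \<le>
          ln (1 / (3 * s (n k))) * (\<Sum>p\<in>F k. measure N {p} / cmod (p - a))" for k
      proof -
        define w :: real where "w = (1/2) ^ k / 4 ^ (2 * n k)"
        have "ln 2 / 4 * min 1 (1 / (64 * h)) \<le>
            ln (1 / (3 * s (n k))) * (\<Sum>j=n k..<2 * n k. w * (4 ^ (2 * n k - j) / (4 * s j)))"
          unfolding w_def using s0 by (intro log_energy_ge[where \<Psi> = \<Psi> and k = k] \<Psi>s h n s_small big) auto
        also have "\<dots> \<le> ln (1 / (3 * s (n k))) * (\<Sum>p\<in>F k. measure N {p} / cmod (p - a))"
        proof (rule mult_left_mono)
          have "(\<Sum>j=n k..<2 * n k. w * (4 ^ (2 * n k - j) / (4 * s j)))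
              \<le> w * (\<Sum>p\<in>F k. 1 / cmod (p - a))"
            unfolding sum_distrib_left[symmetric] using sumF by (intro mult_left_mono) (auto simp: w_def)
          also have "\<dots> = (\<Sum>p\<in>F k. w / cmod (p - a))" by (simp add: sum_distrib_left)
          also have "\<dots> \<le> (\<Sum>p\<in>F k. measure N {p} / cmod (p - a))"
            using atoms F(1)[of k] by (intro sum_mono divide_right_mono) (auto simp: w_def cardA)
          finally show "(\<Sum>j=n k..<2 * n k. w * (4 ^ (2 * n k - j) / (4 * s j)))
              \<le> (\<Sum>p\<in>F k. measure N {p} / cmod (p - a))" .
          show "0 \<le> ln (1 / (3 * s (n k)))" using r1[of k] s_pos[of "n k"] by simp
        qed
        finally show ?thesis .
      qed
    qed
  qed
  have "integrable N (\<lambda>w. ln (1 + cmod w))"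
  proof (rule integrable_const_bound[of _ "ln (1 + R)"])
    show "AE w in N. norm (ln (1 + cmod w)) \<le> ln (1 + R)"
      using N(3) by (rule eventually_mono) (auto intro!: ln_mono simp: add_pos_nonneg)
    show "(\<lambda>w. ln (1 + cmod w)) \<in> borel_measurable N" by measurable
  qed
  then have "integrable (total_variation (measure N)) (\<lambda>w. ln (1 + cmod w))"
    by (simp add: total_variation_measure[OF N(1,2)])
  moreover have "{a \<in> cantor. capacity_differentiable dom (log_potential (measure N)) a} = {}"
    using nondiff by auto
  then have "hausdorff_measure \<Psi>
      {a \<in> cantor. capacity_differentiable dom (log_potential (measure N)) a} = 0"
    by (simp only: hausdorff_measure_empty[of \<Psi>, OF assms(1)])
  ultimately show ?thesis
    using compact_cantor hausdorff_measure_cantor_pos[of \<Psi> h, OF assms(1,4) h \<Psi>s]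
      signed_borel_measure_measure[OF N(1,2)] by blast
qed

end
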